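(* Let $M_\lambda$ be a Hermitian $\mathfrak{o}$-module of type $\lambda=(\lambda_1,\ldots,\lambda_n)$ with $\lambda_1\ge\cdots\ge\lambda_n\ge1$, and let $\mathrm{Aut}^H(M_\lambda)$ be the group of $\mathfrak{o}$-module automorphisms of $M_\lambda$ preserving the pairing. Then $$\#\mathrm{Aut}^H(M_\lambda)=q^{|\lambda|+2n(\lambda)}\prod_{i\ge1}(-q^{-1};-q^{-1})_{m_i(\lambda)}.$$
   Context: $F$ is a non-archimedean local field with an involution $*$, fixed field $F_0$, $F/F_0$ unramified; $\mathfrak{o}$ the ring of integers of $F$, $\mathfrak{p}$ its maximal ideal, $\pi\in F_0\cap\mathfrak{p}$ a generator of $\mathfrak{p}$, $q^2=\#\mathfrak{o}/\mathfrak{p}$. A Hermitian $\mathfrak{o}$-module of type $\lambda$ is $\bigoplus_{i=1}^n\mathfrak{o}/\mathfrak{p}^{\lambda_i}$ with pairing $\langle x,y\rangle=\sum_i\pi^{-\lambda_i}x_i^*y_i\in F/\mathfrak{o}$. $|\lambda|=\sum\lambda_i$, $n(\lambda)=\sum_i(i-1)\lambda_i$, $m_i(\lambda)=\#\{j:\lambda_j=i\}$, $(a;x)_k=\prod_{l=0}^{k-1}(1-ax^l)$. *)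

theory Defs
  imports Complex_Main "HOL-Library.FuncSet"
begin

text \<open>
  A valuation is a function \<open>v :: 'a \<Rightarrow> int\<close> whose value at \<open>0\<close> (mathematically
  \<open>\<infinity>\<close>) is never used.
\<close>

definition integers :: "('a::field \<Rightarrow> int) \<Rightarrow> 'a set" where
  "integers v = {x. x = 0 \<or> 0 \<le> v x}"

text \<open>The power \<open>\<pp>\<^sup>k\<close> of the maximal ideal; \<open>k = 0\<close> is the ring of integers itself.\<close>

definition pow_ideal :: "('a::field \<Rightarrow> int) \<Rightarrow> nat \<Rightarrow> 'a set" where
  "pow_ideal v k = {x. x = 0 \<or> int k \<le> v x}"

definition max_ideal :: "('a::field \<Rightarrow> int) \<Rightarrow> 'a set" where
  "max_ideal v = pow_ideal v 1"

definition cong_rel :: "('a::field \<Rightarrow> int) \<Rightarrow> nat \<Rightarrow> ('a \<times> 'a) set" where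
  "cong_rel v k = {(x, y). x \<in> integers v \<and> y \<in> integers v \<and> x - y \<in> pow_ideal v k}"

definition quot :: "('a::field \<Rightarrow> int) \<Rightarrow> nat \<Rightarrow> 'a set set" where
  "quot v k = integers v // cong_rel v k"

text \<open>
  A non-archimedean local field (of any characteristic): a field that is complete with respect
  to a discrete valuation, normalised to have value group \<open>\<int>\<close>, and has finite residue field.
\<close>

locale nonarch_local_field =
  fixes v :: "'a::field \<Rightarrow> int"
  assumes val_mult: "\<And>x y. x \<noteq> 0 \<Longrightarrow> y \<noteq> 0 \<Longrightarrow> v (x * y) = v x + v y"
    and val_add: "\<And>x y. x \<noteq> 0 \<Longrightarrow> y \<noteq> 0 \<Longrightarrow> x + y \<noteq> 0 \<Longrightarrow> min (v x) (v y) \<le> v (x + y)"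
    and val_normalised: "\<exists>x. x \<noteq> 0 \<and> v x = 1"
    and complete: "\<And>s :: nat \<Rightarrow> 'a.
          (\<forall>k. \<exists>N. \<forall>m\<ge>N. \<forall>n\<ge>N. s m - s n \<in> pow_ideal v k) \<Longrightarrow>
          \<exists>l. \<forall>k. \<exists>N. \<forall>n\<ge>N. s n - l \<in> pow_ideal v k"
    and finite_residue_field: "finite (quot v 1)"

text \<open>
  An involution is a field automorphism of order exactly two, so that \<open>F\<close> is a quadratic
  extension of the fixed field.
\<close>

locale field_involution =
  fixes star :: "'a::field \<Rightarrow> 'a"
  assumes star_add: "\<And>x y. star (x + y) = star x + star y"
    and star_mult: "\<And>x y. star (x * y) = star x * star y"
    and star_star: "\<And>x. star (star x) = x"
    and star_nontrivial: "\<exists>x. star x \<noteq> x"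

definition fixed_field :: "('a::field \<Rightarrow> 'a) \<Rightarrow> 'a set" where
  "fixed_field star = {x. star x = x}"

text \<open>
  Ramification index one, that is, the subfield \<open>K\<close> has the same value group as the whole field.
  The usual additional requirement that the residue field extension be separable is automatic
  for finite residue fields.
\<close>

definition unramified_over :: "('a::field \<Rightarrow> int) \<Rightarrow> 'a set \<Rightarrow> bool" where
  "unramified_over v K \<longleftrightarrow> v ` (K - {0}) = v ` (UNIV - {0})"

text \<open>
  The module \<open>\<Oplus>\<^sub>i \<oo>/\<pp>\<^bsup>\<lambda>\<^sub>i\<^esup>\<close>. Partitions are lists, so parts are indexed from \<open>0\<close>, and an
  element of the module is an extensional function from indices to residue classes.
  Operations on classes are the usual unions over representatives.
\<close>

definition herm_carrier :: "('a::field \<Rightarrow> int) \<Rightarrow> nat list \<Rightarrow> (nat \<Rightarrow> 'a set) set" where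
  "herm_carrier v lam = (\<Pi>\<^sub>E i\<in>{..<length lam}. quot v (lam ! i))"

definition herm_add ::
  "('a::field \<Rightarrow> int) \<Rightarrow> nat list \<Rightarrow> (nat \<Rightarrow> 'a set) \<Rightarrow> (nat \<Rightarrow> 'a set) \<Rightarrow> nat \<Rightarrow> 'a set" where
  "herm_add v lam X Y =
     (\<lambda>i\<in>{..<length lam}. \<Union>x\<in>X i. \<Union>y\<in>Y i. cong_rel v (lam ! i) `` {x + y})"

definition herm_smult ::
  "('a::field \<Rightarrow> int) \<Rightarrow> nat list \<Rightarrow> 'a \<Rightarrow> (nat \<Rightarrow> 'a set) \<Rightarrow> nat \<Rightarrow> 'a set" where
  "herm_smult v lam a X =
     (\<lambda>i\<in>{..<length lam}. \<Union>x\<in>X i. cong_rel v (lam ! i) `` {a * x})"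

text \<open>The pairing, with values in \<open>F/\<oo>\<close>, whose elements are classes of this relation.\<close>

definition cong_integers :: "('a::field \<Rightarrow> int) \<Rightarrow> ('a \<times> 'a) set" where
  "cong_integers v = {(x, y). x - y \<in> integers v}"

definition herm_pairing ::
  "('a::field \<Rightarrow> int) \<Rightarrow> ('a \<Rightarrow> 'a) \<Rightarrow> 'a \<Rightarrow> nat list \<Rightarrow>
   (nat \<Rightarrow> 'a set) \<Rightarrow> (nat \<Rightarrow> 'a set) \<Rightarrow> 'a set" where
  "herm_pairing v star \<pi> lam X Y =
     (\<Union>x\<in>Pi {..<length lam} X. \<Union>y\<in>Pi {..<length lam} Y.
        cong_integers v `` {\<Sum>i<length lam. inverse (\<pi> ^ (lam ! i)) * star (x i) * y i})"

text \<open>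
  The underlying set of the automorphism group. Automorphisms are extensional functions, so that
  each is counted once.
\<close>

definition herm_aut ::
  "('a::field \<Rightarrow> int) \<Rightarrow> ('a \<Rightarrow> 'a) \<Rightarrow> 'a \<Rightarrow> nat list \<Rightarrow>
   ((nat \<Rightarrow> 'a set) \<Rightarrow> (nat \<Rightarrow> 'a set)) set" where
  "herm_aut v star \<pi> lam =
     {\<phi> \<in> extensional (herm_carrier v lam).
        bij_betw \<phi> (herm_carrier v lam) (herm_carrier v lam) \<and>
        (\<forall>X\<in>herm_carrier v lam. \<forall>Y\<in>herm_carrier v lam.
           \<phi> (herm_add v lam X Y) = herm_add v lam (\<phi> X) (\<phi> Y)) \<and>
        (\<forall>a\<in>integers v. \<forall>X\<in>herm_carrier v lam.
           \<phi> (herm_smult v lam a X) = herm_smult v lam a (\<phi> X)) \<and>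
        (\<forall>X\<in>herm_carrier v lam. \<forall>Y\<in>herm_carrier v lam.
           herm_pairing v star \<pi> lam (\<phi> X) (\<phi> Y) = herm_pairing v star \<pi> lam X Y)}"

definition is_type :: "nat list \<Rightarrow> bool" where
  "is_type lam \<longleftrightarrow> sorted_wrt (\<ge>) lam \<and> (\<forall>l\<in>set lam. 1 \<le> l)"

text \<open>\<open>n(\<lambda>) = \<Sum>\<^sub>i (i - 1) \<lambda>\<^sub>i\<close>, where indexing from \<open>0\<close> absorbs the shift.\<close>

definition n_stat :: "nat list \<Rightarrow> nat" where
  "n_stat lam = (\<Sum>i<length lam. i * lam ! i)"

definition q_poch :: "real \<Rightarrow> real \<Rightarrow> nat \<Rightarrow> real" where
  "q_poch a x k = (\<Prod>l<k. 1 - a * x ^ l)"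

end

theory Submission
  imports Defs "HOL-Library.Function_Algebras"
begin

text \<open>
  Write \<open>M\<^sub>\<lambda> = L/D\<close> with lattices \<open>D \<subseteq> L\<close> in \<open>F\<^sup>n\<close>. An isometry is determined by the images of the
  standard basis vectors, and these images can be any family \<open>f\<^sub>1, \<dots>, f\<^sub>n\<close> of pairwise orthogonal
  vectors with \<open>\<langle>f\<^sub>i, f\<^sub>i\<rangle> = \<pi>\<^bsup>-\<lambda>\<^sub>i\<^esup>\<close> and \<open>\<pi>\<^bsup>\<lambda>\<^sub>i\<^esup> f\<^sub>i = 0\<close>. Such frames are counted one vector at a
  time: \<open>f\<^sub>1\<close> splits off an orthogonal summand, and the complement \<open>H\<close> is again nondegenerate. No
  classification of Hermitian modules is needed, because the number of vectors \<open>f \<in> H\<close> with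
  \<open>\<langle>f, f\<rangle> = \<pi>\<^bsup>-r\<^esup>\<close>, where \<open>\<pi>\<^sup>r H = 0\<close>, depends only on the sizes of the submodules \<open>H[\<pi>\<^sup>i]\<close>. Indeed
  all unit values of \<open>\<pi>\<^sup>r \<langle>f, f\<rangle>\<close> are taken equally often, as the norm is surjective on units, and
  the number of vectors with a nonunit value satisfies a linear recursion under splitting.

  The local field enters through two facts: the involution preserves the valuation, and it acts
  nontrivially on the residue field.
\<close>

section \<open>Automorphisms of a local field\<close>

text \<open>The base -1/q of the final product comes from the recursion for nonunit norms. Let p_m
  be the proportion of x in H with \<open>nrm r x\<close> in the maximal ideal, where q^(2m) is the
  index of H[\<pi>^(r-1)] in H. Splitting off one vector of unit norm gives p_(m+1) = (q+1)/q^2 -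
  p_m/q. Its fixed point is 1/q, the deviation from it is multiplied by -1/q at each step, and p_0 =
  1. Each frame vector therefore contributes a factor 1 - (-1/q)^m, and m drops by one with every
  vector of the same exponent r.

  Its substitute is an integer \<theta> with \<theta> - \<open>star\<close> \<theta> a unit. It
  yields an element of trace one, a basis of the integers over the fixed integers, the nonvanishing
  needed for Hilbert 90, and polarization.

  Cardinalities are those of images of sets of representatives, so that orthogonal decompositions
  may divide in F before passing to the quotient.\<close>

context nonarch_local_field
begin

abbreviation "\<O> \<equiv> integers v"
abbreviation "\<P> \<equiv> pow_ideal v"

section \<open>Powers of the maximal ideal, integers and units\<close>

lemma P_0: "\<P> 0 = \<O>"
  by (auto simp: pow_ideal_def integers_def)

lemma val_one: "v 1 = 0"
  using val_mult[of 1 1] by simp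

lemma val_minus: "v (- x) = v x"
proof (cases "x = 0")
  case False
  have "v ((-1) * (-1)) = 2 * v (-1)" by (subst val_mult) auto
  then have "v (-1) = 0" by (simp add: val_one)
  then show ?thesis using val_mult[of "-1" x] False by simp
qed simp

lemma val_inverse: "x \<noteq> 0 \<Longrightarrow> v (inverse x) = - v x"
  using val_mult[of x "inverse x"] by (simp add: val_one)

lemma val_power: "x \<noteq> 0 \<Longrightarrow> v (x ^ n) = int n * v x"
  by (induction n) (auto simp: val_one val_mult algebra_simps)

lemma P_zero [simp]: "0 \<in> \<P> k"
  by (simp add: pow_ideal_def)

lemma P_add: "x \<in> \<P> k \<Longrightarrow> y \<in> \<P> k \<Longrightarrow> x + y \<in> \<P> k"
  using val_add[of x y] by (cases "x = 0"; cases "y = 0"; cases "x + y = 0") (auto simp: pow_ideal_def)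

lemma P_minus: "x \<in> \<P> k \<Longrightarrow> - x \<in> \<P> k"
  by (auto simp: pow_ideal_def val_minus)

lemma P_minus_iff [simp]: "- x \<in> \<P> k \<longleftrightarrow> x \<in> \<P> k"
  using P_minus[of x k] P_minus[of "-x" k] by auto

lemma P_diff: "x \<in> \<P> k \<Longrightarrow> y \<in> \<P> k \<Longrightarrow> x - y \<in> \<P> k"
  using P_add[of x k "-y"] by simp

lemma P_commute: "x - y \<in> \<P> k \<longleftrightarrow> y - x \<in> \<P> k"
  using P_minus_iff[of "x - y" k] by simp

lemma P_mult: "x \<in> \<P> j \<Longrightarrow> y \<in> \<P> k \<Longrightarrow> x * y \<in> \<P> (j + k)"
  by (cases "x = 0"; cases "y = 0") (auto simp: pow_ideal_def val_mult)

lemma P_mono: "x \<in> \<P> k \<Longrightarrow> j \<le> k \<Longrightarrow> x \<in> \<P> j"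
  by (auto simp: pow_ideal_def)

lemma P_sum: "(\<And>i. i \<in> I \<Longrightarrow> f i \<in> \<P> k) \<Longrightarrow> sum f I \<in> \<P> k"
  by (induction I rule: infinite_finite_induct) (auto intro: P_add)

lemma P_all_imp_zero:
  assumes "\<And>k. x \<in> \<P> k" shows "x = 0"
  using assms[of "nat (v x) + 1"] by (auto simp: pow_ideal_def split: if_splits)

lemma O_one [simp]: "1 \<in> \<O>"
  by (simp add: integers_def val_one)

lemma O_zero [simp]: "0 \<in> \<O>"
  by (simp add: integers_def)

lemma O_add: "x \<in> \<O> \<Longrightarrow> y \<in> \<O> \<Longrightarrow> x + y \<in> \<O>"
  and O_diff: "x \<in> \<O> \<Longrightarrow> y \<in> \<O> \<Longrightarrow> x - y \<in> \<O>"
  and O_minus: "x \<in> \<O> \<Longrightarrow> - x \<in> \<O>"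
  and O_mult: "x \<in> \<O> \<Longrightarrow> y \<in> \<O> \<Longrightarrow> x * y \<in> \<O>"
  using P_add[of x 0 y] P_diff[of x 0 y] P_mult[of x 0 y 0] P_minus[of x 0] by (auto simp: P_0)

lemma O_power: "x \<in> \<O> \<Longrightarrow> x ^ n \<in> \<O>"
  by (induction n) (auto intro: O_mult)

lemma O_of_nat: "of_nat n \<in> \<O>"
  by (induction n) (auto intro: O_add)

lemma O_numeral: "numeral n \<in> \<O>"
  using O_of_nat[of "numeral n"] by simp

lemma P_imp_O: "x \<in> \<P> k \<Longrightarrow> x \<in> \<O>"
  using P_mono[of x k 0] by (simp add: P_0)

lemma P_mult_O: "x \<in> \<P> k \<Longrightarrow> a \<in> \<O> \<Longrightarrow> x * a \<in> \<P> k" "x \<in> \<P> k \<Longrightarrow> a \<in> \<O> \<Longrightarrow> a * x \<in> \<P> k"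
  using P_mult[of x k a 0] P_mult[of a 0 x k] by (auto simp: P_0)

definition units :: "'a set" where
  "units = {x \<in> \<O>. x \<notin> \<P> 1}"

lemma units_iff: "x \<in> units \<longleftrightarrow> x \<noteq> 0 \<and> v x = 0"
  by (auto simp: units_def integers_def pow_ideal_def)

lemma units_mult: "x \<in> units \<Longrightarrow> y \<in> units \<Longrightarrow> x * y \<in> units"
  and units_inverse: "x \<in> units \<Longrightarrow> inverse x \<in> units"
  by (auto simp: units_iff val_mult val_inverse)

lemma units_divide: "x \<in> units \<Longrightarrow> y \<in> units \<Longrightarrow> x / y \<in> units"
  by (simp add: divide_inverse units_mult units_inverse)

lemma units_imp_O: "x \<in> units \<Longrightarrow> x \<in> \<O>"
  by (simp add: units_def)

lemma units_nonzero: "x \<in> units \<Longrightarrow> x \<noteq> 0"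
  by (simp add: units_iff)

lemma one_units [simp]: "1 \<in> units"
  by (simp add: units_iff val_one)

lemma units_minus: "x \<in> units \<Longrightarrow> - x \<in> units"
  by (simp add: units_iff val_minus)

lemma P_cancel_unit: "u \<in> units \<Longrightarrow> u * x \<in> \<P> k \<longleftrightarrow> x \<in> \<P> k"
  by (cases "x = 0") (auto simp: units_iff pow_ideal_def val_mult)

lemma units_cong:
  assumes "x \<in> units" "y - x \<in> \<P> 1" shows "y \<in> units"
proof -
  have "y \<in> \<O>" using O_add[of "y - x" x] assms by (auto simp: units_def P_imp_O)
  moreover have "y \<notin> \<P> 1" using P_diff[of y 1 "y - x"] assms by (auto simp: units_def)
  ultimately show ?thesis by (simp add: units_def)
qed

text \<open>Banach's fixed point theorem with distances measured by powers of the maximal ideal; it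
  takes the place of Hensel's lemma for the root equations below. Consecutive iterates starting at 0
  differ by elements of ever higher powers, and the limit is fixed because \<open>g l - l\<close>
  lies in all of them.\<close>

lemma contraction_fixed_point:
  assumes maps: "\<And>x. x \<in> \<P> 1 \<Longrightarrow> g x \<in> \<P> 1"
    and contr: "\<And>x y k. x \<in> \<P> 1 \<Longrightarrow> y \<in> \<P> 1 \<Longrightarrow> x - y \<in> \<P> k \<Longrightarrow> g x - g y \<in> \<P> (Suc k)"
  shows "\<exists>z \<in> \<P> 1. g z = z"
proof -
  define s where "s n = (g ^^ n) 0" for n
  have s_Suc: "s (Suc n) = g (s n)" for n by (simp add: s_def)
  have sP: "s n \<in> \<P> 1" for n by (induction n) (simp add: s_def, simp add: s_Suc maps del: One_nat_def)
  have step: "s (Suc n) - s n \<in> \<P> n" for n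
  proof (induction n)
    case 0
    then show ?case using sP[of 1] by (simp add: s_def P_0 P_imp_O)
  next
    case (Suc n)
    then show ?case using contr[OF sP sP Suc] by (simp add: s_Suc)
  qed
  have tail: "s (N + m) - s N \<in> \<P> N" for N m
  proof (induction m)
    case (Suc m)
    have "s (Suc (N + m)) - s (N + m) \<in> \<P> N" using step[of "N + m"] by (rule P_mono) simp
    from P_add[OF this Suc] show ?case by simp
  qed simp
  have cauchy: "s m - s n \<in> \<P> k" if "m \<ge> k" "n \<ge> k" for m n k
  proof -
    have "s m - s k \<in> \<P> k" "s n - s k \<in> \<P> k" using tail[of k "m - k"] tail[of k "n - k"] that by auto
    from P_diff[OF this] show ?thesis by simp
  qed
  then have "\<forall>k. \<exists>N. \<forall>m\<ge>N. \<forall>n\<ge>N. s m - s n \<in> \<P> k" by blast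
  from complete[OF this] obtain l where l: "\<forall>k. \<exists>N. \<forall>n\<ge>N. s n - l \<in> \<P> k" by blast
  have lim: "\<exists>n\<ge>m. s n - l \<in> \<P> k" for k m
  proof -
    obtain N where "\<forall>n\<ge>N. s n - l \<in> \<P> k" using l by blast
    then show ?thesis by (intro exI[of _ "max N m"]) auto
  qed
  obtain n where "s n - l \<in> \<P> 1" using lim by blast
  from P_diff[OF sP[of n] this] have lP: "l \<in> \<P> 1" by simp
  have "g l - l \<in> \<P> k" for k
  proof -
    obtain N where N: "\<forall>n\<ge>N. s n - l \<in> \<P> k" using l by blast
    then have "s N - l \<in> \<P> k" "s (Suc N) - l \<in> \<P> k" by auto
    moreover from contr[OF sP lP this(1)] have "g (s N) - g l \<in> \<P> k" by (rule P_mono) simp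
    ultimately have "(s (Suc N) - l) - (g (s N) - g l) \<in> \<P> k" using P_diff by blast
    then show ?thesis by (simp add: s_Suc)
  qed
  then have "g l = l" using P_all_imp_zero[of "g l - l"] by simp
  with lP show ?thesis by blast
qed

text \<open>
  It follows that elements of \<open>1 + \<pp>\<close> have \<open>l\<^sup>n\<close>-th roots for all \<open>n\<close>, so that every discrete valuation,
  in particular \<open>v \<circ> star\<close>, vanishes on them. This gives \<open>v \<circ> star = v\<close>.
\<close>

lemma one_plus_ideal_divisible:
  "\<exists>l\<ge>2. \<forall>w \<in> \<P> 1. \<exists>z \<in> \<P> 1. (1 + z) ^ l = 1 + w"
proof (cases "(2::'a) \<in> \<P> 1")
  case False
  then have u: "(2::'a) \<in> units" by (simp add: units_def O_numeral)
  then have n0: "(2::'a) \<noteq> 0" by (rule units_nonzero)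
  have "\<exists>z \<in> \<P> 1. (1 + z) ^ 2 = 1 + w" if w: "w \<in> \<P> 1" for w
  proof -
    \<comment> \<open>Expanding (1 + z)^2 = 1 + w and solving for the linear term gives this fixed
      point equation; the quadratic term contracts on the maximal ideal.\<close>
    have "\<exists>z \<in> \<P> 1. (w - z ^ 2) / 2 = z"
    proof (rule contraction_fixed_point)
      fix x :: 'a assume x: "x \<in> \<P> 1"
      then have "w - x * x \<in> \<P> 1" using w by (intro P_diff P_mult_O P_imp_O[of x 1])
      moreover have "2 * ((w - x ^ 2) / 2) = w - x * x" using n0 by (simp add: power2_eq_square)
      ultimately have "2 * ((w - x ^ 2) / 2) \<in> \<P> 1" by (simp only:)
      then show "(w - x ^ 2) / 2 \<in> \<P> 1" using P_cancel_unit[OF u] by blast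
    next
      fix x y k assume "x \<in> \<P> 1" "y \<in> \<P> 1" "x - y \<in> \<P> k"
      then have "(x - y) * (x + y) \<in> \<P> (k + 1)" by (intro P_mult P_add)
      then have "- ((x - y) * (x + y)) \<in> \<P> (Suc k)" by simp
      also have "- ((x - y) * (x + y)) = (w - x ^ 2) - (w - y ^ 2)" by algebra
      also have "\<dots> = 2 * ((w - x ^ 2) / 2 - (w - y ^ 2) / 2)"
        using n0 by (simp flip: diff_divide_distrib)
      finally have "2 * ((w - x ^ 2) / 2 - (w - y ^ 2) / 2) \<in> \<P> (Suc k)" .
      then show "(w - x ^ 2) / 2 - (w - y ^ 2) / 2 \<in> \<P> (Suc k)" using P_cancel_unit[OF u] by blast
    qed
    then obtain z where z: "z \<in> \<P> 1" "(w - z ^ 2) / 2 = z" by blast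
    from z(2) n0 have "w - z ^ 2 = z * 2" by (simp add: field_simps)
    then have "(1 + z) ^ 2 = 1 + w" by algebra
    with z show ?thesis by blast
  qed
  then show ?thesis by (intro exI[of _ 2]) auto
next
  case True
  \<comment> \<open>If 2 is not a unit, then 3 = 1 + 2 is one, and cube roots are available
    instead.\<close>
  have u: "(3::'a) \<in> units" by (rule units_cong[of 1]) (use True in auto)
  then have n0: "(3::'a) \<noteq> 0" by (rule units_nonzero)
  have "\<exists>z \<in> \<P> 1. (1 + z) ^ 3 = 1 + w" if w: "w \<in> \<P> 1" for w
  proof -
    have "\<exists>z \<in> \<P> 1. (w - 3 * z ^ 2 - z ^ 3) / 3 = z"
    proof (rule contraction_fixed_point)
      fix x :: 'a assume x: "x \<in> \<P> 1"
      then have "w - x * (3 * x) - x * (x * x) \<in> \<P> 1"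
        using w by (intro P_diff P_mult_O O_mult O_numeral P_imp_O[of x 1])
      moreover have "3 * ((w - 3 * x ^ 2 - x ^ 3) / 3) = w - x * (3 * x) - x * (x * x)"
        using n0 by (simp add: power2_eq_square power3_eq_cube)
      ultimately have "3 * ((w - 3 * x ^ 2 - x ^ 3) / 3) \<in> \<P> 1" by (simp only:)
      then show "(w - 3 * x ^ 2 - x ^ 3) / 3 \<in> \<P> 1" using P_cancel_unit[OF u] by blast
    next
      fix x y k assume xy: "x \<in> \<P> 1" "y \<in> \<P> 1" and d: "x - y \<in> \<P> k"
      from xy have "3 * (x + y) + (x * x + x * y + y * y) \<in> \<P> 1"
        by (auto intro!: P_add P_mult_O O_numeral intro: P_imp_O)
      with d have "(x - y) * (3 * (x + y) + (x * x + x * y + y * y)) \<in> \<P> (k + 1)" by (intro P_mult)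
      then have "- ((x - y) * (3 * (x + y) + (x * x + x * y + y * y))) \<in> \<P> (Suc k)" by simp
      also have "- ((x - y) * (3 * (x + y) + (x * x + x * y + y * y)))
          = (w - 3 * x ^ 2 - x ^ 3) - (w - 3 * y ^ 2 - y ^ 3)"
        by algebra
      also have "\<dots> = 3 * ((w - 3 * x ^ 2 - x ^ 3) / 3 - (w - 3 * y ^ 2 - y ^ 3) / 3)"
        using n0 by (simp flip: diff_divide_distrib)
      finally show "(w - 3 * x ^ 2 - x ^ 3) / 3 - (w - 3 * y ^ 2 - y ^ 3) / 3 \<in> \<P> (Suc k)"
        using P_cancel_unit[OF u] by blast
    qed
    then obtain z where z: "z \<in> \<P> 1" "(w - 3 * z ^ 2 - z ^ 3) / 3 = z" by blast
    from z(2) n0 have "w - 3 * z ^ 2 - z ^ 3 = z * 3" by (simp add: field_simps)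
    then have "(1 + z) ^ 3 = 1 + w" by algebra
    with z show ?thesis by blast
  qed
  then show ?thesis by (intro exI[of _ 3]) auto
qed

text \<open>A coset of p^k in all of F, so that \<open>cls_eq_iff\<close> needs no integrality
  conditions. For integral x it is the class under \<open>cong_rel\<close>, by
  \<open>cong_rel_cls\<close>.\<close>

definition cls :: "nat \<Rightarrow> 'a \<Rightarrow> 'a set" where
  "cls k x = {y. y - x \<in> \<P> k}"

lemma cls_eq_iff: "cls k x = cls k y \<longleftrightarrow> x - y \<in> \<P> k"
proof
  assume "cls k x = cls k y"
  moreover have "x \<in> cls k x" by (simp add: cls_def)
  ultimately have "x \<in> cls k y" by simp
  then show "x - y \<in> \<P> k" by (simp add: cls_def)
next
  assume a: "x - y \<in> \<P> k"
  have "z - x \<in> \<P> k \<longleftrightarrow> z - y \<in> \<P> k" for z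
    using P_add[OF a, of "z - x"] P_diff[of "z - y" k "x - y"] a by auto
  then show "cls k x = cls k y" by (simp add: cls_def)
qed

lemma cong_rel_cls: "x \<in> \<O> \<Longrightarrow> cong_rel v k `` {x} = cls k x"
  using O_add[of x] P_imp_O by (fastforce simp: cong_rel_def cls_def P_commute)

lemma quot_conv: "quot v k = cls k ` \<O>"
  by (auto simp: quot_def quotient_def cong_rel_cls)

text \<open>Pigeonhole in the finite residue field. It reduces the valuation of
  \<open>star u\<close> for a unit u to the case of elements of 1 + p.\<close>

lemma units_power_one_plus_ideal:
  assumes u: "u \<in> units"
  shows "\<exists>n>0. u ^ n - 1 \<in> \<P> 1"
proof -
  have uO: "u ^ n \<in> \<O>" for n using u by (simp add: O_power units_imp_O)
  have "\<not> inj (\<lambda>n. cls 1 (u ^ n))"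
  proof
    assume "inj (\<lambda>n::nat. cls 1 (u ^ n))"
    moreover have "finite (range (\<lambda>n. cls 1 (u ^ n)))"
      by (rule finite_subset[OF _ finite_residue_field]) (auto simp: quot_conv uO)
    ultimately show False using finite_imageD infinite_UNIV_nat by blast
  qed
  then obtain m n where mn: "m \<noteq> n" "u ^ m - u ^ n \<in> \<P> 1"
    unfolding inj_def cls_eq_iff by blast
  have aux: "\<exists>n>0. u ^ n - 1 \<in> \<P> 1" if "m < n" "u ^ n - u ^ m \<in> \<P> 1" for m n
  proof -
    have "u ^ m * (u ^ (n - m) - 1) \<in> \<P> 1"
      using that by (simp add: algebra_simps flip: power_add)
    moreover have "u ^ m \<in> units" using u by (simp add: units_iff val_power)
    ultimately show ?thesis using P_cancel_unit[of "u ^ m"] that(1) by (intro exI[of _ "n - m"]) auto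
  qed
  show ?thesis using mn aux[of m n] aux[of n m] by (cases "m < n") (auto simp: P_commute)
qed

end

text \<open>Unramifiedness is carried by a uniformizer fixed by \<open>star\<close>. That
  \<open>star\<close> preserves the valuation is not assumed but derived in
  \<open>val_star\<close>.\<close>

locale unramified_hermitian_field = nonarch_local_field v + field_involution star
  for v :: "'a::field \<Rightarrow> int" and star :: "'a \<Rightarrow> 'a" +
  fixes \<pi> :: 'a and q :: nat
  assumes star_pi [simp]: "star \<pi> = \<pi>"
    and pi_nonzero [simp]: "\<pi> \<noteq> 0"
    and val_pi: "v \<pi> = 1"
    and card_residue: "card (quot v 1) = q ^ 2"
begin

section \<open>Invariance of the valuation under the involution\<close>

lemma star_zero [simp]: "star 0 = 0"
  using star_add[of 0 0] by (metis add_cancel_right_right add.right_neutral)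

lemma star_minus: "star (- x) = - star x"
  using star_add[of x "- x"] by (simp add: eq_neg_iff_add_eq_0 add.commute)

lemma star_diff: "star (x - y) = star x - star y"
  using star_add[of x "- y"] by (simp add: star_minus)

lemma star_eq_0_iff [simp]: "star x = 0 \<longleftrightarrow> x = 0"
  using star_star[of x] by auto

lemma star_one [simp]: "star 1 = 1"
  using star_mult[of 1 1] by simp

lemma star_inverse: "star (inverse x) = inverse (star x)"
proof (cases "x = 0")
  case False
  then have "star x * star (inverse x) = 1" by (simp flip: star_mult)
  then show ?thesis by (metis inverse_unique)
qed simp

lemma star_divide: "star (x / y) = star x / star y"
  by (simp add: divide_inverse star_mult star_inverse)

lemma star_power: "star (x ^ n) = star x ^ n"
  by (induction n) (auto simp: star_mult)

lemma star_sum: "star (sum f I) = (\<Sum>i\<in>I. star (f i))"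
  by (induction I rule: infinite_finite_induct) (auto simp: star_add)

lemma val_pi_power: "v (\<pi> ^ n) = int n"
  by (simp add: val_power val_pi)

lemma P_iff: "x \<in> \<P> k \<longleftrightarrow> x / \<pi> ^ k \<in> \<O>"
  by (cases "x = 0") (auto simp: pow_ideal_def integers_def divide_inverse val_mult val_inverse val_pi_power)

lemma P_pi_cancel: "\<pi> ^ j * x \<in> \<P> (j + k) \<longleftrightarrow> x \<in> \<P> k"
  by (simp add: P_iff power_add)

lemma pi_P: "\<pi> ^ k \<in> \<P> k"
  by (simp add: P_iff)

lemma pi_O: "\<pi> ^ k \<in> \<O>"
  using pi_P by (rule P_imp_O)

lemma val_star_one_plus:
  assumes "w \<in> \<P> 1" shows "v (star (1 + w)) = 0"
proof -
  obtain l where l: "l \<ge> 2" "\<forall>w \<in> \<P> 1. \<exists>z \<in> \<P> 1. (1 + z) ^ l = 1 + w"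
    using one_plus_ideal_divisible by blast
  have nz: "star (1 + w) \<noteq> 0" if "w \<in> \<P> 1" for w
    using units_cong[of 1 "1 + w"] that by (auto dest: units_nonzero)
  have dvd: "int l ^ n dvd v (star (1 + w))" if "w \<in> \<P> 1" for n w
    using that
  proof (induction n arbitrary: w)
    case (Suc n)
    then obtain z where z: "z \<in> \<P> 1" "(1 + z) ^ l = 1 + w" using l by blast
    have "v (star (1 + w)) = int l * v (star (1 + z))"
      by (simp only: z(2)[symmetric] star_power val_power[OF nz[OF z(1)]])
    then show ?case using Suc.IH[OF z(1)] by simp
  qed simp
  define m where "m = v (star (1 + w))"
  show ?thesis
  proof (rule ccontr)
    assume "v (star (1 + w)) \<noteq> 0"
    \<comment> \<open>The exponent is the absolute value of m because l^k > k for all k: a nonzero m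
      has no divisor that large.\<close>
    then have "\<bar>int l ^ nat \<bar>m\<bar>\<bar> \<le> \<bar>m\<bar>" using dvd_imp_le_int[OF _ dvd[OF assms]] by (auto simp: m_def)
    then have "l ^ nat \<bar>m\<bar> \<le> nat \<bar>m\<bar>" by (simp flip: of_nat_power add: nat_le_iff le_nat_iff)
    also have "nat \<bar>m\<bar> < 2 ^ nat \<bar>m\<bar>" by (rule less_exp)
    also have "(2::nat) ^ nat \<bar>m\<bar> \<le> l ^ nat \<bar>m\<bar>" using l(1) by (rule power_mono) simp
    finally show False by simp
  qed
qed

lemma val_star_units:
  assumes "u \<in> units" shows "v (star u) = 0"
proof -
  obtain n where n: "n > 0" "u ^ n - 1 \<in> \<P> 1" using units_power_one_plus_ideal[OF assms] by blast
  have "int n * v (star u) = v (star (1 + (u ^ n - 1)))"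
    using assms by (simp add: star_power val_power units_nonzero)
  also have "\<dots> = 0" by (rule val_star_one_plus[OF n(2)])
  finally show ?thesis using n(1) by simp
qed

lemma val_star: "v (star x) = v x"
proof -
  have *: "v (star x) = v x" if "x \<noteq> 0" "v x \<ge> 0" for x
  proof -
    define u where "u = x / \<pi> ^ nat (v x)"
    have u: "u \<in> units"
      using that by (simp add: units_iff u_def divide_inverse val_mult val_inverse val_pi_power)
    have "x = u * \<pi> ^ nat (v x)" by (simp add: u_def)
    then have "v (star x) = v (star u) + v (\<pi> ^ nat (v x))"
      using u by (metis star_mult star_power star_pi val_mult star_eq_0_iff units_nonzero power_not_zero pi_nonzero)
    then show ?thesis using val_star_units[OF u] that by (simp add: val_pi_power)
  qed
  consider "x = 0" | "x \<noteq> 0" "v x \<ge> 0" | "x \<noteq> 0" "v (inverse x) \<ge> 0"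
    using val_inverse[of x] by linarith
  then show ?thesis
  proof cases
    case 3
    then have "v (star (inverse x)) = v (inverse x)" using *[of "inverse x"] by simp
    with 3 show ?thesis by (simp add: star_inverse val_inverse)
  qed (use * in auto)
qed

lemma star_P [simp]: "star x \<in> \<P> k \<longleftrightarrow> x \<in> \<P> k"
  by (simp add: pow_ideal_def val_star)

lemma star_O [simp]: "star x \<in> \<O> \<longleftrightarrow> x \<in> \<O>"
  by (simp add: integers_def val_star)

lemma star_units [simp]: "star x \<in> units \<longleftrightarrow> x \<in> units"
  by (simp add: units_iff val_star)

text \<open>In residue characteristic 2 squaring is additive modulo p, hence injective on the finite
  residue field and therefore surjective. The square root replaces halving in
  \<open>ex_unit_star_diff\<close>.\<close>

lemma residue_square_root:
  assumes two: "(2::'a) \<in> \<P> 1" and x: "x \<in> \<O>"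
  shows "\<exists>z \<in> \<O>. x - z ^ 2 \<in> \<P> 1"
proof -
  define g where "g c = cls 1 ((SOME x. x \<in> \<O> \<and> c = cls 1 x) ^ 2)" for c
  have sq: "x ^ 2 - y ^ 2 \<in> \<P> 1 \<longleftrightarrow> x - y \<in> \<P> 1" if "x \<in> \<O>" "y \<in> \<O>" for x y
  proof -
    have e: "x ^ 2 - y ^ 2 = (x - y) ^ 2 + 2 * (y * (x - y))" by algebra
    have "2 * (y * (x - y)) \<in> \<P> 1" using two that by (intro P_mult_O O_mult O_diff)
    then have "x ^ 2 - y ^ 2 \<in> \<P> 1 \<longleftrightarrow> (x - y) ^ 2 \<in> \<P> 1"
      unfolding e using P_add P_diff[of "(x - y) ^ 2 + 2 * (y * (x - y))" 1 "2 * (y * (x - y))"] by auto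
    also have "\<dots> \<longleftrightarrow> x - y \<in> \<P> 1"
      using that by (cases "x = y") (auto simp: power2_eq_square pow_ideal_def val_mult)
    finally show ?thesis .
  qed
  have g: "g (cls 1 x) = cls 1 (x ^ 2)" if "x \<in> \<O>" for x
  proof -
    let ?y = "SOME y. y \<in> \<O> \<and> cls 1 x = cls 1 y"
    have y: "?y \<in> \<O> \<and> cls 1 x = cls 1 ?y" by (rule someI[of _ x]) (use that in simp)
    then have "x - ?y \<in> \<P> 1" by (simp only: cls_eq_iff)
    then have "x ^ 2 - ?y ^ 2 \<in> \<P> 1" using sq[of x ?y] that y by blast
    then show ?thesis unfolding g_def by (simp only: cls_eq_iff P_commute)
  qed
  have "g ` quot v 1 = quot v 1"
  proof (rule endo_inj_surj[OF finite_residue_field])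
    show "g ` quot v 1 \<subseteq> quot v 1" by (auto simp: quot_conv g O_power simp del: One_nat_def)
    show "inj_on g (quot v 1)"
    proof (rule inj_onI)
      fix c d assume "c \<in> quot v 1" "d \<in> quot v 1" and e: "g c = g d"
      then obtain x y where xy: "x \<in> \<O>" "y \<in> \<O>" "c = cls 1 x" "d = cls 1 y"
        unfolding quot_conv by blast
      with e have "cls 1 (x ^ 2) = cls 1 (y ^ 2)" by (simp only: g)
      then have "x - y \<in> \<P> 1" using sq xy by (simp only: cls_eq_iff)
      then show "c = d" by (simp only: cls_eq_iff xy)
    qed
  qed
  then have "cls 1 x \<in> g ` quot v 1" using x by (auto simp: quot_conv)
  then obtain z where "z \<in> \<O>" "cls 1 x = cls 1 (z ^ 2)" by (auto simp: quot_conv g simp del: One_nat_def)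
  then show ?thesis by (auto simp: cls_eq_iff)
qed

text \<open>If \<open>star\<close> acted trivially on residues, every integer would be congruent
  modulo p to a fixed one. Since \<pi> is fixed, this improves digit by digit to all powers of p, so
  every integer would be fixed, against \<open>star_nontrivial\<close>.\<close>

lemma ex_unit_star_diff: "\<exists>\<theta> \<in> \<O>. \<theta> - star \<theta> \<in> units"
proof (rule ccontr)
  assume "\<not> ?thesis"
  then have triv: "x - star x \<in> \<P> 1" if "x \<in> \<O>" for x
    using that by (auto simp: units_def O_diff)
  have approx1: "\<exists>y \<in> \<O>. star y = y \<and> x - y \<in> \<P> 1" if x: "x \<in> \<O>" for x
  proof (cases "(2::'a) \<in> \<P> 1")
    case True
    then obtain z where z: "z \<in> \<O>" "x - z ^ 2 \<in> \<P> 1" using residue_square_root x by blast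
    \<comment> \<open>The fixed approximation of x is the norm of z, which is congruent to z^2
      because \<open>star z\<close> is congruent to z.\<close>
    have "z * (z - star z) \<in> \<P> 1" using z triv by (intro P_mult_O) auto
    from P_add[OF z(2) this] have "x - z * star z \<in> \<P> 1" by (simp add: power2_eq_square algebra_simps)
    then show ?thesis using z
      by (intro bexI[of _ "z * star z"]) (auto simp: star_mult star_star O_mult mult.commute)
  next
    case False
    then have u: "(2::'a) \<in> units" by (simp add: units_def O_numeral)
    have two: "star 2 = 2" using star_add[of 1 1] by simp
    define y where "y = (x + star x) / 2"
    have "y \<in> \<O>" unfolding y_def divide_inverse
      using x units_inverse[OF u] by (intro O_mult O_add) (auto intro: units_imp_O)
    moreover have "star y = y" by (simp add: y_def star_divide star_add star_star two add.commute)
    moreover have "2 * (x - y) = x - star x"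
      using units_nonzero[OF u] by (simp add: y_def field_simps)
    ultimately show ?thesis using triv[OF x] P_cancel_unit[OF u] by metis
  qed
  have approx: "\<exists>y \<in> \<O>. star y = y \<and> x - y \<in> \<P> k" if x: "x \<in> \<O>" for x k
  proof (induction k)
    case 0
    show ?case using x by (intro bexI[of _ 0]) (auto simp: P_0)
  next
    case (Suc k)
    then obtain y where y: "y \<in> \<O>" "star y = y" "x - y \<in> \<P> k" by blast
    define a where "a = (x - y) / \<pi> ^ k"
    have "a \<in> \<O>" using y(3) by (simp add: a_def P_iff)
    then obtain b where b: "b \<in> \<O>" "star b = b" "a - b \<in> \<P> 1" using approx1 by blast
    have "x - y = \<pi> ^ k * a" by (simp add: a_def)
    then have "x - (y + \<pi> ^ k * b) = \<pi> ^ k * (a - b)" by (simp add: algebra_simps)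
    also have "\<dots> \<in> \<P> (Suc k)" using P_mult[OF pi_P b(3), of k] by simp
    finally show ?case using y b pi_O
      by (intro bexI[of _ "y + \<pi> ^ k * b"]) (auto simp: star_add star_mult star_power intro!: O_add O_mult)
  qed
  have fixO: "star x = x" if x: "x \<in> \<O>" for x
  proof -
    have "x - star x \<in> \<P> k" for k
    proof -
      obtain y where y: "star y = y" "x - y \<in> \<P> k" using approx[OF x] by blast
      then have "star (x - y) \<in> \<P> k" by simp
      from P_diff[OF y(2) this] show ?thesis by (simp add: star_diff y(1))
    qed
    then show ?thesis using P_all_imp_zero[of "x - star x"] by simp
  qed
  have "star x = x" for x
  proof (cases "x \<in> \<O>")
    case False
    then have "inverse x \<in> \<O>" by (auto simp: integers_def val_inverse)
    then show ?thesis using fixO[of "inverse x"] by (simp add: star_inverse)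
  qed (rule fixO)
  then show False using star_nontrivial by blast
qed

end

section \<open>Counting residues\<close>

lemma card_image_cong_kernel:
  assumes "\<And>x y. x \<in> S \<Longrightarrow> y \<in> S \<Longrightarrow> f x = f y \<longleftrightarrow> g x = g y"
  shows "card (f ` S) = card (g ` S)"
proof (rule bij_betw_same_card)
  have inv: "inv_into S f (f x) \<in> S" "f (inv_into S f (f x)) = f x" if "x \<in> S" for x
    using that by (auto intro: inv_into_into f_inv_into_f)
  then have g: "g (inv_into S f (f x)) = g x" if "x \<in> S" for x
    using assms that by blast
  show "bij_betw (g \<circ> inv_into S f) (f ` S) (g ` S)"
    unfolding bij_betw_def inj_on_def using assms g by (auto simp: image_iff)
qed

text \<open>Quotients are compared through maps of representatives: \<open>t\<close> induces a
  bijection from the f-classes of S to the g-classes of T.\<close>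

lemma card_image_transfer:
  assumes "\<And>x. x \<in> S \<Longrightarrow> t x \<in> T"
    and "\<And>y. y \<in> T \<Longrightarrow> \<exists>x\<in>S. g (t x) = g y"
    and "\<And>x y. x \<in> S \<Longrightarrow> y \<in> S \<Longrightarrow> f x = f y \<longleftrightarrow> g (t x) = g (t y)"
  shows "card (f ` S) = card (g ` T)"
proof -
  have "g ` T = (\<lambda>x. g (t x)) ` S"
    using assms(1,2) by (auto simp: image_iff) metis
  then show ?thesis using card_image_cong_kernel[of S f "\<lambda>x. g (t x)"] assms(3) by simp
qed

text \<open>Counting along the map that \<open>m\<close> induces on f-classes, when all its fibres
  have equal size. The size is real so that formulas with divisions by powers of q can be
  substituted.\<close>

lemma card_image_fibres:
  assumes fin: "finite (f ` S)" "finite T" and sub: "m ` S \<subseteq> T"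
    and dep: "\<And>x y. x \<in> S \<Longrightarrow> y \<in> S \<Longrightarrow> f x = f y \<Longrightarrow> m x = m y"
    and n: "\<And>d. d \<in> T \<Longrightarrow> real (card (f ` {x \<in> S. m x = d})) = n"
  shows "real (card (f ` S)) = n * real (card T)"
proof -
  have "f ` S = (\<Union>d\<in>T. f ` {x \<in> S. m x = d})" using sub by auto
  also have "card \<dots> = (\<Sum>d\<in>T. card (f ` {x \<in> S. m x = d}))"
  proof (rule card_UN_disjoint)
    show "\<forall>d\<in>T. finite (f ` {x \<in> S. m x = d})"
      by (auto intro: finite_subset[OF _ fin(1)])
    show "\<forall>d\<in>T. \<forall>e\<in>T. d \<noteq> e \<longrightarrow> f ` {x \<in> S. m x = d} \<inter> f ` {x \<in> S. m x = e} = {}"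
      using dep by blast
  qed (fact fin)
  finally show ?thesis using n by (simp add: mult.commute)
qed

context nonarch_local_field
begin

lemma cls_P_1: "k \<ge> 1 \<Longrightarrow> cls k x = cls k y \<Longrightarrow> x - y \<in> \<P> 1"
  unfolding cls_eq_iff by (rule P_mono)

lemma units_cls:
  "k \<ge> 1 \<Longrightarrow> cls k x = cls k y \<Longrightarrow> x \<in> units \<longleftrightarrow> y \<in> units"
  using cls_P_1[of k x y] units_cong[of x y] units_cong[of y x] P_commute[of x y 1] by blast

end

section \<open>Numbers of residue classes\<close>

context unramified_hermitian_field
begin

lemma card_cls_fibre:
  assumes x: "x \<in> \<O>"
  shows "card (cls (Suc r) ` {y \<in> \<O>. cls 1 y = cls 1 x}) = card (cls r ` \<O>)"
proof (rule card_image_transfer[symmetric, where t = "\<lambda>a. x + \<pi> * a"])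
  have pi: "\<pi> * a \<in> \<P> (Suc k) \<longleftrightarrow> a \<in> \<P> k" for a k
    using P_pi_cancel[of 1 a k] by simp
  show "x + \<pi> * a \<in> {y \<in> \<O>. cls 1 y = cls 1 x}" if "a \<in> \<O>" for a
    using that x pi[of a 0] by (auto simp: cls_eq_iff P_0 intro: O_add P_imp_O)
  show "\<exists>a\<in>\<O>. cls (Suc r) (x + \<pi> * a) = cls (Suc r) y" if "y \<in> {y \<in> \<O>. cls 1 y = cls 1 x}" for y
  proof (rule bexI)
    show "cls (Suc r) (x + \<pi> * ((y - x) / \<pi>)) = cls (Suc r) y" by simp
    show "(y - x) / \<pi> \<in> \<O>" using that P_iff[of "y - x" 1] by (simp add: cls_eq_iff)
  qed
  show "cls r a = cls r b \<longleftrightarrow> cls (Suc r) (x + \<pi> * a) = cls (Suc r) (x + \<pi> * b)" for a b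
    using pi[of "a - b" r] by (simp add: cls_eq_iff algebra_simps)
qed

text \<open>Writing x = y + \<pi> a with y a representative modulo p covers the classes by pairs of
  classes. Finiteness comes before the count because \<open>card_image_fibres\<close> presupposes
  it.\<close>

lemma finite_cls: "finite (cls r ` \<O>)"
proof (induction r)
  case 0
  have "cls 0 x = cls 0 0" if "x \<in> \<O>" for x using that unfolding cls_eq_iff by (simp add: P_0)
  then have "cls 0 ` \<O> \<subseteq> {cls 0 0}" by blast
  then show ?case by (rule finite_subset) simp
next
  case (Suc r)
  have pi: "\<pi> * a \<in> \<P> (Suc k) \<longleftrightarrow> a \<in> \<P> k" for a k
    using P_pi_cancel[of 1 a k] by simp
  define rep where "rep k c = (SOME x. x \<in> \<O> \<and> c = cls k x)" for k c
  have rep: "rep k (cls k x) \<in> \<O> \<and> cls k x = cls k (rep k (cls k x))" if "x \<in> \<O>" for k x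
    unfolding rep_def by (rule someI[of _ x]) (use that in simp)
  have "cls (Suc r) ` \<O> \<subseteq> (\<lambda>(c, d). cls (Suc r) (rep 1 c + \<pi> * rep r d)) ` (quot v 1 \<times> cls r ` \<O>)"
  proof
    fix C assume "C \<in> cls (Suc r) ` \<O>"
    then obtain x where x: "x \<in> \<O>" "C = cls (Suc r) x" by blast
    let ?y = "rep 1 (cls 1 x)"
    let ?a = "(x - ?y) / \<pi>"
    have y: "?y \<in> \<O>" "x - ?y \<in> \<P> 1" using rep[OF x(1), of 1] cls_eq_iff[of 1 x ?y] by auto
    then have a: "?a \<in> \<O>" using P_iff[of "x - ?y" 1] by simp
    then have "\<pi> * (?a - rep r (cls r ?a)) \<in> \<P> (Suc r)"
      using rep[OF a, of r] cls_eq_iff[of r ?a] pi by blast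
    also have "\<pi> * (?a - rep r (cls r ?a)) = x - (?y + \<pi> * rep r (cls r ?a))"
      by (simp only: right_diff_distrib) simp
    finally have "C = cls (Suc r) (?y + \<pi> * rep r (cls r ?a))" unfolding x(2) cls_eq_iff .
    then show "C \<in> (\<lambda>(c, d). cls (Suc r) (rep 1 c + \<pi> * rep r d)) ` (quot v 1 \<times> cls r ` \<O>)"
      using x(1) a by (intro image_eqI[of _ _ "(cls 1 x, cls r ?a)"]) (auto simp: quot_conv)
  qed
  then show ?case by (rule finite_subset) (use Suc finite_residue_field in auto)
qed

lemma finite_cls_subset: "S \<subseteq> \<O> \<Longrightarrow> finite (cls r ` S)"
  by (rule finite_subset[OF _ finite_cls]) auto

lemma q_gt_1: "q > 1"
proof -
  have "cls 1 0 \<noteq> cls 1 1" using P_minus_iff[of 1 1] one_units by (simp add: cls_eq_iff units_def)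
  then have "card {cls 1 0, cls 1 1} = 2" by (rule card_2_iff[THEN iffD2, OF exI, OF exI, OF conjI, OF refl])
  moreover have "card {cls 1 0, cls 1 1} \<le> card (quot v 1)"
    by (rule card_mono[OF finite_residue_field]) (auto simp: quot_conv)
  ultimately have "2 \<le> q ^ 2" by (simp add: card_residue del: One_nat_def)
  then show ?thesis by (cases "q = 0 \<or> q = 1") auto
qed

lemma card_cls: "card (cls r ` \<O>) = q ^ (2 * r)"
proof (induction r)
  case 0
  have "cls 0 x = cls 0 0" if "x \<in> \<O>" for x using that unfolding cls_eq_iff by (simp add: P_0)
  then have "cls 0 ` \<O> = (\<lambda>_. cls 0 0) ` \<O>" by (rule image_cong[OF refl])
  also have "\<dots> = {cls 0 0}" by (rule image_constant[OF O_zero])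
  finally have "cls 0 ` \<O> = {cls 0 0}" .
  then show ?case by simp
next
  case (Suc r)
  have "real (card (cls (Suc r) ` \<O>)) = real (q ^ (2 * r)) * real (card (quot v 1))"
  proof (rule card_image_fibres[where m = "cls 1"])
    show "finite (quot v 1)" by (rule finite_residue_field)
    show "real (card (cls (Suc r) ` {x \<in> \<O>. cls 1 x = d})) = real (q ^ (2 * r))" if "d \<in> quot v 1" for d
    proof -
      from that obtain x where "x \<in> \<O>" "d = cls 1 x" by (auto simp: quot_conv)
      then show ?thesis using card_cls_fibre Suc by simp
    qed
  next
    fix x y assume "cls (Suc r) x = cls (Suc r) y"
    then show "cls 1 x = cls 1 y" unfolding cls_eq_iff by (rule P_mono) simp
  qed (auto simp: finite_cls quot_conv)
  then show ?case
    by (simp add: card_residue power2_eq_square mult.assoc del: One_nat_def flip: of_nat_power of_nat_mult)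
qed

text \<open>Scaling by \<pi>^i identifies p^i/p^r with o/p^(r-i). Truncated subtraction gives the
  right value 1 for i > r, where p^i lies in a single class.\<close>

lemma card_cls_P: "card (cls r ` \<P> i) = q ^ (2 * (r - i))"
proof (cases "i \<le> r")
  case True
  have "card (cls (r - i) ` \<O>) = card (cls r ` \<P> i)"
  proof (rule card_image_transfer[where t = "\<lambda>a. \<pi> ^ i * a"])
    show "\<pi> ^ i * a \<in> \<P> i" if "a \<in> \<O>" for a using that P_pi_cancel[of i a 0] by (simp add: P_0)
    show "\<exists>a\<in>\<O>. cls r (\<pi> ^ i * a) = cls r y" if "y \<in> \<P> i" for y
      using that by (intro bexI[of _ "y / \<pi> ^ i"]) (auto simp: P_iff)
    show "cls (r - i) a = cls (r - i) b \<longleftrightarrow> cls r (\<pi> ^ i * a) = cls r (\<pi> ^ i * b)" for a b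
      using P_pi_cancel[of i "a - b" "r - i"] True by (simp add: cls_eq_iff algebra_simps)
  qed
  then show ?thesis by (simp add: card_cls)
next
  case False
  have "cls r x = cls r 0" if "x \<in> \<P> i" for x
    using P_mono[OF that, of r] False unfolding cls_eq_iff by simp
  then have "cls r ` \<P> i = (\<lambda>_. cls r 0) ` \<P> i" by (rule image_cong[OF refl])
  also have "\<dots> = {cls r 0}" by (rule image_constant[OF P_zero])
  finally have "cls r ` \<P> i = {cls r 0}" .
  then show ?thesis using False by simp
qed

section \<open>Elements fixed by the involution\<close>

definition sym_ints :: "'a set" where
  "sym_ints = {x \<in> \<O>. star x = x}"

definition sym_units :: "'a set" where
  "sym_units = {x \<in> units. star x = x}"

lemma sym_units_sub: "sym_units \<subseteq> \<O>" "units \<subseteq> \<O>" "sym_ints \<subseteq> \<O>"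
  by (auto simp: sym_units_def units_def sym_ints_def)

text \<open>The coefficient of \<theta> is x - \<open>star x\<close> divided by \<theta> -
  \<open>star\<close> \<theta>, which is integral since the divisor is a unit. The same division
  shows that divisibility by p^k can be read off the coefficients.\<close>

lemma sym_decomposition:
  obtains \<theta> where "\<theta> \<in> \<O>"
    "\<And>x. x \<in> \<O> \<Longrightarrow> \<exists>a\<in>sym_ints. \<exists>b\<in>sym_ints. x = a + b * \<theta>"
    "\<And>a b k. a \<in> sym_ints \<Longrightarrow> b \<in> sym_ints \<Longrightarrow> a + b * \<theta> \<in> \<P> k \<longleftrightarrow> a \<in> \<P> k \<and> b \<in> \<P> k"
proof -
  obtain \<theta> where th: "\<theta> \<in> \<O>" "\<theta> - star \<theta> \<in> units" using ex_unit_star_diff by blast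
  have nz: "\<theta> - star \<theta> \<noteq> 0" using th(2) by (rule units_nonzero)
  have 1: "\<exists>a\<in>sym_ints. \<exists>b\<in>sym_ints. x = a + b * \<theta>" if x: "x \<in> \<O>" for x
  proof -
    define b where "b = (x - star x) / (\<theta> - star \<theta>)"
    have b: "b \<in> \<O>" unfolding b_def divide_inverse
      using x th units_inverse by (intro O_mult O_diff) (auto intro: units_imp_O)
    have "star b = (star x - x) / (star \<theta> - \<theta>)" by (simp add: b_def star_divide star_diff star_star)
    also have "\<dots> = b" using minus_divide_divide[of "x - star x" "\<theta> - star \<theta>"] by (simp add: b_def)
    finally have sb: "star b = b" .
    have "b * (\<theta> - star \<theta>) = x - star x" using nz by (simp add: b_def)
    then have "star x - b * star \<theta> = x - b * \<theta>" by (simp add: algebra_simps)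
    then have "x - b * \<theta> \<in> sym_ints" "b \<in> sym_ints"
      using x b th sb by (auto simp: sym_ints_def star_diff star_mult intro!: O_diff O_mult)
    then show ?thesis by (intro bexI[of _ "x - b * \<theta>"] bexI[of _ b]) auto
  qed
  have 2: "a + b * \<theta> \<in> \<P> k \<longleftrightarrow> a \<in> \<P> k \<and> b \<in> \<P> k" if ab: "a \<in> sym_ints" "b \<in> sym_ints" for a b k
  proof
    assume l: "a + b * \<theta> \<in> \<P> k"
    then have "star (a + b * \<theta>) \<in> \<P> k" by simp
    then have "a + b * star \<theta> \<in> \<P> k" using ab by (simp add: star_add star_mult sym_ints_def)
    from P_diff[OF l this] have "(\<theta> - star \<theta>) * b \<in> \<P> k" by (simp add: algebra_simps)
    then have b: "b \<in> \<P> k" using P_cancel_unit th(2) by blast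
    from P_diff[OF l P_mult_O(1)[OF this th(1)]] b show "a \<in> \<P> k \<and> b \<in> \<P> k" by simp
  qed (use ab th in \<open>auto simp: sym_ints_def intro!: P_add P_mult_O(1)\<close>)
  show ?thesis by (rule that[OF th(1) 1 2])
qed

text \<open>\<open>\<tau>\<close> has trace one, so x minus the trace of \<tau> x equals
  \<open>star \<tau> * (x - star x)\<close>. This is the averaging argument without division by
  2.\<close>

lemma sym_approx:
  assumes x: "x \<in> \<O>" "x - star x \<in> \<P> k" shows "\<exists>a\<in>sym_ints. x - a \<in> \<P> k"
proof -
  obtain \<theta> where th: "\<theta> \<in> \<O>" "\<theta> - star \<theta> \<in> units" using ex_unit_star_diff by blast
  define \<tau> where "\<tau> = \<theta> / (\<theta> - star \<theta>)"
  have "star \<tau> = - (star \<theta> / (\<theta> - star \<theta>))"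
    using minus_divide_divide[of "star \<theta>" "star \<theta> - \<theta>"] by (simp add: \<tau>_def star_divide star_diff star_star)
  then have tr: "\<tau> + star \<tau> = 1" using units_nonzero[OF th(2)]
    by (simp add: \<tau>_def flip: diff_divide_distrib)
  have tO: "\<tau> \<in> \<O>" unfolding \<tau>_def divide_inverse using th units_inverse by (intro O_mult) (auto intro: units_imp_O)
  let ?a = "\<tau> * x + star (\<tau> * x)"
  have "x = (\<tau> + star \<tau>) * x" by (simp add: tr)
  then have "x - ?a = star \<tau> * (x - star x)" by (simp add: star_mult algebra_simps)
  moreover have "star \<tau> * (x - star x) \<in> \<P> k" using tO x by (intro P_mult_O) auto
  moreover have "?a \<in> sym_ints" using tO x by (auto simp: sym_ints_def star_add star_star add.commute intro!: O_add O_mult)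
  ultimately show ?thesis by metis
qed

text \<open>The basis 1, \<theta> turns pairs of classes of fixed integers into classes of o/p^r, so
  the square of the number sought is q^(2r).\<close>

lemma card_cls_sym: "card (cls r ` sym_ints) = q ^ r"
proof -
  obtain \<theta> where th: "\<theta> \<in> \<O>"
    "\<And>x. x \<in> \<O> \<Longrightarrow> \<exists>a\<in>sym_ints. \<exists>b\<in>sym_ints. x = a + b * \<theta>"
    "\<And>a b k. a \<in> sym_ints \<Longrightarrow> b \<in> sym_ints \<Longrightarrow> a + b * \<theta> \<in> \<P> k \<longleftrightarrow> a \<in> \<P> k \<and> b \<in> \<P> k"
    using sym_decomposition by metis
  have sd: "a - b \<in> sym_ints" if "a \<in> sym_ints" "b \<in> sym_ints" for a b
    using that by (auto simp: sym_ints_def star_diff O_diff)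
  have "card (map_prod (cls r) (cls r) ` (sym_ints \<times> sym_ints)) = card (cls r ` \<O>)"
  proof (rule card_image_transfer[where t = "\<lambda>(a, b). a + b * \<theta>"])
    show "(case x of (a, b) \<Rightarrow> a + b * \<theta>) \<in> \<O>" if "x \<in> sym_ints \<times> sym_ints" for x
      using that th(1) by (auto simp: sym_ints_def intro!: O_add O_mult)
    show "\<exists>x\<in>sym_ints \<times> sym_ints. cls r (case x of (a, b) \<Rightarrow> a + b * \<theta>) = cls r y" if "y \<in> \<O>" for y
      using th(2)[OF that] by auto
    fix x y assume xy: "x \<in> sym_ints \<times> sym_ints" "y \<in> sym_ints \<times> sym_ints"
    obtain a b a' b' where e: "x = (a, b)" "y = (a', b')" by (cases x, cases y) auto
    have "(a + b * \<theta>) - (a' + b' * \<theta>) = (a - a') + (b - b') * \<theta>" by (simp add: algebra_simps)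
    then have "(a + b * \<theta>) - (a' + b' * \<theta>) \<in> \<P> r \<longleftrightarrow> a - a' \<in> \<P> r \<and> b - b' \<in> \<P> r"
      using xy th(3)[OF sd sd, of a a' b b' r] by (simp only: e mem_Sigma_iff)
    then show "map_prod (cls r) (cls r) x = map_prod (cls r) (cls r) y \<longleftrightarrow>
        cls r (case x of (a, b) \<Rightarrow> a + b * \<theta>) = cls r (case y of (a, b) \<Rightarrow> a + b * \<theta>)"
      by (simp add: e cls_eq_iff)
  qed
  then have "card (cls r ` sym_ints \<times> cls r ` sym_ints) = q ^ (2 * r)"
    by (simp only: map_prod_surj_on[OF refl refl] card_cls)
  then have "card (cls r ` sym_ints) ^ 2 = (q ^ r) ^ 2"
    by (simp only: card_cartesian_product power2_eq_square mult_2 power_add)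
  then show ?thesis by (simp only: power2_eq_iff_nonneg le0)
qed

lemma card_cls_units:
  assumes "r \<ge> 1" shows "card (cls r ` units) + q ^ (2 * (r - 1)) = q ^ (2 * r)"
proof -
  have "cls r ` \<O> = cls r ` units \<union> cls r ` \<P> 1"
    using P_imp_O by (auto simp: units_def)
  moreover have "cls r ` units \<inter> cls r ` \<P> 1 = {}"
  proof -
    have False if "x \<in> units" "y \<in> \<P> 1" "cls r x = cls r y" for x y
      using units_cls[OF assms that(3)] that by (simp add: units_def)
    then show ?thesis by blast
  qed
  ultimately have "card (cls r ` \<O>) = card (cls r ` units) + card (cls r ` \<P> 1)"
    using P_imp_O[of _ 1] by (simp add: card_Un_disjoint finite_cls_subset sym_units_sub subsetI)
  then show ?thesis using card_cls_P[of r 1] by (simp add: card_cls)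
qed

lemma card_cls_sym_units:
  assumes "r \<ge> 1" shows "card (cls r ` sym_units) + q ^ (r - 1) = q ^ r"
proof -
  have "cls r ` sym_ints = cls r ` sym_units \<union> cls r ` (sym_ints \<inter> \<P> 1)"
    by (auto simp: units_def sym_ints_def sym_units_def)
  moreover have "cls r ` sym_units \<inter> cls r ` (sym_ints \<inter> \<P> 1) = {}"
  proof -
    have False if "x \<in> sym_units" "y \<in> \<P> 1" "cls r x = cls r y" for x y
      using units_cls[OF assms that(3)] that by (simp add: units_def sym_units_def)
    then show ?thesis by blast
  qed
  ultimately have "card (cls r ` sym_ints) = card (cls r ` sym_units) + card (cls r ` (sym_ints \<inter> \<P> 1))"
    using P_imp_O[of _ 1] sym_units_sub by (simp add: card_Un_disjoint finite_cls_subset le_infI1)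
  moreover have "card (cls (r - 1) ` sym_ints) = card (cls r ` (sym_ints \<inter> \<P> 1))"
  proof (rule card_image_transfer[where t = "\<lambda>a. \<pi> * a"])
    show "\<pi> * a \<in> sym_ints \<inter> \<P> 1" if "a \<in> sym_ints" for a
      using that P_pi_cancel[of 1 a 0] by (auto simp: sym_ints_def star_mult P_0 intro: P_imp_O)
    show "\<exists>a\<in>sym_ints. cls r (\<pi> * a) = cls r y" if "y \<in> sym_ints \<inter> \<P> 1" for y
      using that P_iff[of y 1] by (intro bexI[of _ "y / \<pi>"]) (auto simp: sym_ints_def star_divide)
    show "cls (r - 1) a = cls (r - 1) b \<longleftrightarrow> cls r (\<pi> * a) = cls r (\<pi> * b)" for a b
      using P_pi_cancel[of 1 "a - b" "r - 1"] assms by (simp add: cls_eq_iff algebra_simps)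
  qed
  ultimately show ?thesis by (simp add: card_cls_sym)
qed

text \<open>
  Modulo \<open>\<pp>\<^sup>r\<close>, the unit group has the endomorphisms \<open>a \<mapsto> a a\<^sup>*\<close> and \<open>a \<mapsto> a / a\<^sup>*\<close>. By Hilbert 90
  the kernel \<open>K\<close> of the first is the image of the second, whose kernel consists of the symmetric
  units. Hence the image of the norm has as many elements as there are symmetric units.
\<close>

lemma hilbert_90:
  assumes a: "a \<in> units" "a * star a - 1 \<in> \<P> r" and r: "r \<ge> 1"
  shows "\<exists>b\<in>units. b / star b - a \<in> \<P> r"
proof -
  obtain \<theta> where th: "\<theta> \<in> \<O>" "\<theta> - star \<theta> \<in> units" using ex_unit_star_diff by blast
  define b where "b c = c + a * star c" for c
  have aO: "a \<in> \<O>" using a by (simp add: units_def)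
  \<comment> \<open>If all values of b were nonunits, then so would be
    \<open>b \<theta> - star \<theta> * b 1\<close>, which equals
    \<open>\<theta> - star \<theta>\<close>.\<close>
  have "\<exists>c\<in>\<O>. b c \<in> units"
  proof (rule ccontr)
    assume "\<not> ?thesis"
    moreover have "b c \<in> \<O>" if "c \<in> \<O>" for c
      using that aO unfolding b_def by (intro O_add O_mult) auto
    ultimately have n: "b c \<in> \<P> 1" if "c \<in> \<O>" for c
      using that unfolding units_def by blast
    from P_diff[OF n[OF th(1)] P_mult_O(2)[OF n[OF O_one]], of "star \<theta>"] th
    show False by (simp add: b_def units_def algebra_simps)
  qed
  then obtain c where c: "c \<in> \<O>" "b c \<in> units" by blast
  have s: "star (b c) \<in> units" using c by simp
  have "b c - a * star (b c) = - c * (a * star a - 1)"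
    by (simp add: b_def star_add star_mult star_star algebra_simps)
  also have "\<dots> \<in> \<P> r" using a c by (intro P_mult_O O_minus)
  finally have "star (b c) * (b c / star (b c) - a) \<in> \<P> r"
    using units_nonzero[OF s] by (simp add: algebra_simps)
  then have "b c / star (b c) - a \<in> \<P> r" using P_cancel_unit[OF s] by blast
  with c show ?thesis by blast
qed

lemma norm_surj:
  assumes r: "r \<ge> 1" and c: "c \<in> sym_units"
  shows "\<exists>a\<in>units. a * star a - c \<in> \<P> r"
proof -
  define K where "K = {a \<in> units. a * star a - 1 \<in> \<P> r}"
  have fin: "finite (cls r ` S)" if "S \<subseteq> units" for S
    using that sym_units_sub(2) by (intro finite_cls_subset) auto
  have KU: "K \<subseteq> units" by (auto simp: K_def)
  have N_dep: "x * star x - y * star y \<in> \<P> r" if "x - y \<in> \<P> r" "x \<in> \<O>" "y \<in> \<O>" for x y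
  proof -
    have "x * star x - y * star y = (x - y) * star x + y * star (x - y)"
      by (simp add: star_diff algebra_simps)
    also have "\<dots> \<in> \<P> r" using that by (intro P_add P_mult_O) auto
    finally show ?thesis .
  qed
  have scale_cls: "cls r (x * a) = cls r (x * b) \<longleftrightarrow> cls r a = cls r b" if "x \<in> units" for x a b
    using P_cancel_unit[OF that, of "a - b" r] by (simp add: cls_eq_iff algebra_simps)
  \<comment> \<open>The fibre of the norm through x is the translate of K by x.\<close>
  have 1: "real (card (cls r ` units)) = real (card (cls r ` K)) * real (card ((\<lambda>a. cls r (a * star a)) ` units))"
  proof (rule card_image_fibres[where m = "\<lambda>a. cls r (a * star a)"])
    have "(\<lambda>a. cls r (a * star a)) ` units \<subseteq> cls r ` units"
      using units_mult by auto
    then show "finite ((\<lambda>a. cls r (a * star a)) ` units)" using fin finite_subset by blast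
    show "cls r (x * star x) = cls r (y * star y)" if "x \<in> units" "y \<in> units" "cls r x = cls r y" for x y
      using that N_dep by (simp add: cls_eq_iff units_imp_O)
    show "real (card (cls r ` {a \<in> units. cls r (a * star a) = d})) = real (card (cls r ` K))"
      if "d \<in> (\<lambda>a. cls r (a * star a)) ` units" for d
    proof -
      from that obtain x where x: "x \<in> units" "d = cls r (x * star x)" by blast
      have xx: "x * star x \<in> units" using x units_mult by simp
      have eq: "cls r ((x * a) * star (x * a)) = d \<longleftrightarrow> a * star a - 1 \<in> \<P> r" for a
        using P_cancel_unit[OF xx, of "a * star a - 1" r]
        by (simp add: x cls_eq_iff star_mult algebra_simps)
      have "card (cls r ` K) = card (cls r ` {a \<in> units. cls r (a * star a) = d})"
      proof (rule card_image_transfer[where t = "\<lambda>a. x * a"])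
        show "x * a \<in> {a \<in> units. cls r (a * star a) = d}" if "a \<in> K" for a
          using that eq[of a] x by (simp add: K_def units_mult)
        show "\<exists>a\<in>K. cls r (x * a) = cls r y" if "y \<in> {a \<in> units. cls r (a * star a) = d}" for y
          using that eq[of "y / x"] units_nonzero[OF x(1)] x(1)
          by (intro bexI[of _ "y / x"]) (auto simp: K_def units_divide)
      qed (simp add: scale_cls[OF x(1)])
      then show ?thesis by simp
    qed
  qed (auto simp: fin)
  \<comment> \<open>The map to K has nonempty fibres by \<open>hilbert_90\<close>, and they are
    translates of the fixed units.\<close>
  have 2: "real (card (cls r ` units)) = real (card (cls r ` sym_units)) * real (card (cls r ` K))"
  proof (rule card_image_fibres[where m = "\<lambda>a. cls r (a / star a)"])
    show "finite (cls r ` K)" using fin KU by blast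
    have iff: "cls r ((x * a) / star (x * a)) = cls r (x / star x) \<longleftrightarrow> a - star a \<in> \<P> r"
      if "x \<in> units" "a \<in> units" for x a
    proof -
      have u: "x / star x \<in> units" "star a \<in> units" using that units_divide by auto
      have "star a \<noteq> 0" "star x \<noteq> 0" "a \<noteq> 0" using that units_nonzero by auto
      then have "(x * a) / star (x * a) - x / star x = (x / star x) * (a / star a - 1)"
        "a - star a = star a * (a / star a - 1)"
        by (simp_all add: star_mult field_simps)
      then show ?thesis using P_cancel_unit[OF u(1)] P_cancel_unit[OF u(2)] by (metis cls_eq_iff)
    qed
    show "(\<lambda>a. cls r (a / star a)) ` units \<subseteq> cls r ` K"
    proof -
      have "a / star a \<in> K" if "a \<in> units" for a
        using that units_nonzero[OF that] by (auto simp: K_def star_divide star_star units_divide)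
      then show ?thesis by blast
    qed
    show "cls r (x / star x) = cls r (y / star y)" if "x \<in> units" "y \<in> units" "cls r x = cls r y" for x y
    proof -
      have y: "y / x \<in> units" "x * (y / x) = y" using that units_divide units_nonzero by auto
      have "x * (y / x - 1) \<in> \<P> r" using that y units_nonzero[OF that(1)]
        by (simp add: cls_eq_iff right_diff_distrib P_commute)
      then have "y / x - 1 \<in> \<P> r" using P_cancel_unit that(1) by blast
      moreover from this have "star (y / x - 1) \<in> \<P> r" by simp
      then have "star (y / x) - 1 \<in> \<P> r" by (simp add: star_diff)
      ultimately have "y / x - star (y / x) \<in> \<P> r" using P_diff by fastforce
      then show ?thesis using iff[OF that(1) y(1)] y(2) by metis
    qed
    show "real (card (cls r ` {a \<in> units. cls r (a / star a) = d})) = real (card (cls r ` sym_units))"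
      if "d \<in> cls r ` K" for d
    proof -
      from that obtain a where "a \<in> K" "d = cls r a" by blast
      with hilbert_90[OF _ _ r] obtain x where x: "x \<in> units" "d = cls r (x / star x)"
        unfolding K_def by (auto simp: cls_eq_iff P_commute)
      have "card (cls r ` sym_units) = card (cls r ` {a \<in> units. cls r (a / star a) = d})"
      proof (rule card_image_transfer[where t = "\<lambda>a. x * a"])
        show "x * a \<in> {a \<in> units. cls r (a / star a) = d}" if "a \<in> sym_units" for a
          using that iff[of x a] x by (auto simp: sym_units_def units_mult)
        show "\<exists>a\<in>sym_units. cls r (x * a) = cls r y" if y: "y \<in> {a \<in> units. cls r (a / star a) = d}" for y
        proof -
          have yx: "y / x \<in> units" "x * (y / x) = y" using y x units_divide units_nonzero by auto
          then have "y / x - star (y / x) \<in> \<P> r" using iff[OF x(1) yx(1)] y x by (metis (mono_tags, lifting) mem_Collect_eq)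
          \<comment> \<open>The quotient y / x is fixed only modulo p^r; it is replaced by a
            genuinely fixed element of the same class.\<close>
          then obtain a where a: "a \<in> sym_ints" "y / x - a \<in> \<P> r" using sym_approx units_imp_O[OF yx(1)] by blast
          have "a \<in> units" using units_cls[OF r, of a "y / x"] a(2) yx(1) by (simp add: cls_eq_iff P_commute)
          moreover have "cls r (x * a) = cls r y"
            using scale_cls[OF x(1), of a "y / x"] a(2) yx(2) by (simp only: cls_eq_iff P_commute)
          ultimately show ?thesis using a(1) by (intro bexI[of _ a]) (auto simp: sym_units_def sym_ints_def)
        qed
      qed (simp add: scale_cls[OF x(1)])
      then show ?thesis by simp
    qed
  qed (auto simp: fin)
  have "1 \<in> K" by (simp add: K_def)
  then have "card (cls r ` K) > 0" using fin[OF KU] card_gt_0_iff by blast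
  \<comment> \<open>The number of classes of K cancels between the two counts; below, an inclusion
    of finite sets of equal size becomes an equality.\<close>
  with 1 2 have "card ((\<lambda>a. cls r (a * star a)) ` units) = card (cls r ` sym_units)" by simp
  moreover have "(\<lambda>a. cls r (a * star a)) ` units \<subseteq> cls r ` sym_units"
  proof -
    have "a * star a \<in> sym_units" if "a \<in> units" for a
      using that by (simp add: sym_units_def units_mult star_mult star_star mult.commute)
    then show ?thesis by blast
  qed
  moreover have "finite (cls r ` sym_units)" by (rule fin) (auto simp: sym_units_def)
  ultimately have "(\<lambda>a. cls r (a * star a)) ` units = cls r ` sym_units" using card_subset_eq by metis
  then have "cls r c \<in> (\<lambda>a. cls r (a * star a)) ` units" using c by blast
  then show ?thesis by (auto simp: cls_eq_iff P_commute)
qed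

end

section \<open>Finite Hermitian modules\<close>

text \<open>
  A finite Hermitian module is presented as a quotient \<open>L/D\<close> of lattices in a space with an
  \<open>F\<close>-valued Hermitian form; \<open>\<kappa>\<close> is the projection \<open>L \<rightarrow> L/D\<close>. Subsets of the quotient are
  counted as images under \<open>\<kappa>\<close>.
\<close>

locale hermitian_lattice = unramified_hermitian_field v star \<pi> q + vec: vector_space sc
  for v :: "'a::field \<Rightarrow> int" and star :: "'a \<Rightarrow> 'a" and \<pi> :: 'a and q :: nat
    and sc :: "'a \<Rightarrow> 'b::ab_group_add \<Rightarrow> 'b" +
  fixes h :: "'b \<Rightarrow> 'b \<Rightarrow> 'a" and L D :: "'b set" and \<kappa> :: "'b \<Rightarrow> 'c"
  assumes h_add: "h x (y + z) = h x y + h x z"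
    and h_scale: "h x (sc a y) = a * h x y"
    and h_star: "star (h x y) = h y x"
    and D_sub_L: "D \<subseteq> L"
    and D_zero: "0 \<in> D"
    and D_add: "x \<in> D \<Longrightarrow> y \<in> D \<Longrightarrow> x + y \<in> D"
    and D_scale: "a \<in> \<O> \<Longrightarrow> x \<in> D \<Longrightarrow> sc a x \<in> D"
    and h_D: "x \<in> L \<Longrightarrow> d \<in> D \<Longrightarrow> h x d \<in> \<O>"
    and kappa: "x \<in> L \<Longrightarrow> y \<in> L \<Longrightarrow> \<kappa> x = \<kappa> y \<longleftrightarrow> x - y \<in> D"
    and finite_kappa: "finite (\<kappa> ` L)"
    and torsion: "x \<in> L \<Longrightarrow> \<exists>k. sc (\<pi> ^ k) x \<in> D"
begin

section \<open>The form and its nondegenerate submodules\<close>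

lemma h_add_left: "h (x + y) z = h x z + h y z"
  by (metis h_add h_star star_add)

lemma h_scale_left: "h (sc a x) y = star a * h x y"
  by (metis h_scale h_star star_mult)

lemma h_minus: "h x (- y) = - h x y"
  using h_scale[of x "-1" y] by simp

lemma h_minus_left: "h (- x) y = - h x y"
  using h_scale_left[of "-1" x y] by (simp add: star_minus)

lemma h_diff: "h x (y - z) = h x y - h x z"
  using h_add[of x y "- z"] by (simp add: h_minus)

lemma h_diff_left: "h (x - y) z = h x z - h y z"
  using h_add_left[of x "- y" z] by (simp add: h_minus_left)

lemmas h_simps = h_add h_add_left h_scale h_scale_left h_diff h_diff_left

lemma h_O_commute: "h x y \<in> \<O> \<longleftrightarrow> h y x \<in> \<O>"
  using star_O[of "h x y"] by (simp add: h_star)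

lemma D_minus: "x \<in> D \<Longrightarrow> - x \<in> D"
  using D_scale[of "-1" x] by (simp add: O_minus)

lemma D_diff: "x \<in> D \<Longrightarrow> y \<in> D \<Longrightarrow> x - y \<in> D"
  using D_add[of x "- y"] D_minus by simp

text \<open>\<open>H\<close> stands for the submodule H/D of L/D. Containing D makes it the full
  preimage, and the last clause says that the pairing induced on H/D, with values in F/o, has
  trivial radical.\<close>

definition herm_sub :: "'b set \<Rightarrow> bool" where
  "herm_sub H \<longleftrightarrow> D \<subseteq> H \<and> H \<subseteq> L \<and> (\<forall>x\<in>H. \<forall>y\<in>H. x + y \<in> H) \<and>
     (\<forall>a\<in>\<O>. \<forall>x\<in>H. sc a x \<in> H) \<and> (\<forall>x\<in>H. (\<forall>y\<in>H. h x y \<in> \<O>) \<longrightarrow> x \<in> D)"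

lemma herm_subD:
  assumes "herm_sub H"
  shows "x \<in> D \<Longrightarrow> x \<in> H" "x \<in> H \<Longrightarrow> x \<in> L" "x \<in> H \<Longrightarrow> y \<in> H \<Longrightarrow> x + y \<in> H"
    "a \<in> \<O> \<Longrightarrow> x \<in> H \<Longrightarrow> sc a x \<in> H" "x \<in> H \<Longrightarrow> (\<And>y. y \<in> H \<Longrightarrow> h x y \<in> \<O>) \<Longrightarrow> x \<in> D"
  using assms unfolding herm_sub_def by blast+

lemma herm_sub_diff:
  assumes "herm_sub H" "x \<in> H" "y \<in> H" shows "x - y \<in> H"
  using herm_subD(3)[OF assms(1,2), of "- y"] herm_subD(4)[OF assms(1) _ assms(3), of "-1"]
  by (simp add: O_minus)

lemma finite_kappa_sub: "S \<subseteq> L \<Longrightarrow> finite (\<kappa> ` S)"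
  by (rule finite_subset[OF _ finite_kappa]) auto

definition killed :: "nat \<Rightarrow> 'b set \<Rightarrow> 'b set" where
  "killed i H = {x \<in> H. sc (\<pi> ^ i) x \<in> D}"

text \<open>Integral values vanish in F/o, so this is the preimage of the orthogonal complement of
  the class of f.\<close>

definition orth :: "'b set \<Rightarrow> 'b \<Rightarrow> 'b set" where
  "orth H f = {w \<in> H. h f w \<in> \<O>}"

text \<open>Multiplying by \<open>\<pi>\<^sup>r\<close> makes the form integral on modules killed by \<open>\<pi>\<^sup>r\<close>.\<close>

definition nrm :: "nat \<Rightarrow> 'b \<Rightarrow> 'a" where
  "nrm r x = \<pi> ^ r * h x x"

definition splits :: "'b set \<Rightarrow> nat \<Rightarrow> 'b \<Rightarrow> bool" where
  "splits H r f \<longleftrightarrow> herm_sub H \<and> H = killed r H \<and> 1 \<le> r \<and> f \<in> H \<and> nrm r f \<in> units"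

lemma nrm_O:
  assumes "herm_sub H" "H = killed r H" "x \<in> H" shows "nrm r x \<in> \<O>"
proof -
  have "x \<in> L" "sc (\<pi> ^ r) x \<in> D" using assms herm_subD(2) by (auto simp: killed_def)
  from h_D[OF this] show ?thesis by (simp add: h_scale nrm_def)
qed

lemma star_nrm: "star (nrm r x) = nrm r x"
  by (simp add: nrm_def star_mult star_power h_star)

lemma nrm_cong:
  assumes "x \<in> L" "y \<in> L" "x - y \<in> D" shows "nrm r x - nrm r y \<in> \<P> r"
proof -
  have "h x (x - y) + h (x - y) y \<in> \<O>" using assms h_D h_O_commute by (intro O_add) blast+
  then have "\<pi> ^ r * (h x (x - y) + h (x - y) y) \<in> \<P> r" using pi_P by (intro P_mult_O)
  then show ?thesis by (simp add: nrm_def h_simps algebra_simps)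
qed

lemma splitsD:
  assumes "splits H r f"
  shows "herm_sub H" "H = killed r H" "1 \<le> r" "f \<in> H" "nrm r f \<in> units" "h f f \<noteq> 0"
proof -
  show nz: "herm_sub H" "H = killed r H" "1 \<le> r" "f \<in> H" "nrm r f \<in> units"
    using assms by (auto simp: splits_def)
  show "h f f \<noteq> 0" using units_nonzero[OF nz(5)] by (auto simp: nrm_def)
qed

lemma h_pi_r_O:
  assumes "splits H r f" "x \<in> H" shows "\<pi> ^ r * h f x \<in> \<O>"
proof -
  have "f \<in> L" "sc (\<pi> ^ r) x \<in> D"
    using assms splitsD(1,2,4)[OF assms(1)] herm_subD(2) by (auto simp: killed_def)
  from h_D[OF this] show ?thesis by (simp add: h_scale)
qed

text \<open>\<open>h f f\<close> differs from \<pi>^(-r) by a unit factor, so divisibility of the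
  coefficient along f can be tested on \<pi>^r times the value of the form.\<close>

lemma co_iff:
  assumes "splits H r f" shows "z / h f f \<in> \<P> k \<longleftrightarrow> \<pi> ^ r * z \<in> \<P> k"
proof -
  have "nrm r f * (z / h f f) = \<pi> ^ r * z" using splitsD[OF assms] by (simp add: nrm_def)
  then show ?thesis using P_cancel_unit[OF splitsD(5)[OF assms]] by metis
qed

lemma orth_iff:
  assumes "splits H r f" "w \<in> H" shows "w \<in> orth H f \<longleftrightarrow> h f w / h f f \<in> \<P> r"
  unfolding co_iff[OF assms(1)] using P_pi_cancel[of r "h f w" 0] assms(2)
  by (simp add: orth_def P_0)

text \<open>A vector of the complement that pairs integrally with the complement also does so with
  f, hence with every y = a f + (y - a f) in H, and nondegeneracy of H applies.\<close>

lemma herm_sub_orth: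
  assumes "splits H r f" shows "herm_sub (orth H f)"
proof -
  note H = splitsD(1)[OF assms] and f = splitsD(4)[OF assms]
  note Hs = herm_subD[OF H]
  have "x \<in> D" if x: "x \<in> orth H f" "\<forall>y\<in>orth H f. h x y \<in> \<O>" for x
  proof (rule Hs(5))
    show "x \<in> H" using x by (simp add: orth_def)
    fix y assume y: "y \<in> H"
    define a where "a = h f y / h f f"
    have a: "a \<in> \<O>" using co_iff[OF assms, of "h f y" 0] h_pi_r_O[OF assms y] by (simp add: P_0 a_def)
    have "y - sc a f \<in> H" using a y f H by (intro herm_sub_diff[OF H] Hs(4))
    moreover have "h f (y - sc a f) = 0" using splitsD(6)[OF assms] by (simp add: h_simps a_def)
    ultimately have "y - sc a f \<in> orth H f" by (simp add: orth_def)
    then have "h x (y - sc a f) \<in> \<O>" using x by blast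
    moreover have "h x f \<in> \<O>" using x h_O_commute by (auto simp: orth_def)
    ultimately have "h x (y - sc a f) + a * h x f \<in> \<O>" using a by (intro O_add O_mult)
    then show "h x y \<in> \<O>" by (simp add: h_simps)
  qed
  moreover have "D \<subseteq> orth H f" using Hs(1) h_D Hs(2)[OF f] by (auto simp: orth_def)
  moreover have "orth H f \<subseteq> L" using Hs(2) by (auto simp: orth_def)
  ultimately show ?thesis using Hs(3,4)
    by (auto simp: herm_sub_def orth_def h_simps intro: O_add O_mult)
qed

text \<open>
  \<open>H\<close> is the orthogonal sum of \<open>\<oo> f\<close> and its orthogonal complement, and \<open>h f x / h f f\<close> is the
  coefficient of \<open>f\<close> in \<open>x\<close>.
\<close>

lemma split_count:
  assumes sp: "splits H r f" and S: "S \<subseteq> \<O>"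
    and sat: "\<And>a b. a \<in> S \<Longrightarrow> b \<in> \<O> \<Longrightarrow> b - a \<in> \<P> r \<Longrightarrow> b \<in> S"
    and n: "\<And>a. a \<in> S \<Longrightarrow> real (card (\<kappa> ` {w \<in> orth H f. P (sc a f + w)})) = n"
  shows "real (card (\<kappa> ` {x \<in> H. P x \<and> h f x / h f f \<in> S})) = n * real (card (cls r ` S))"
proof (rule card_image_fibres[where m = "\<lambda>x. cls r (h f x / h f f)"])
  note H = splitsD(1)[OF sp] and f = splitsD(4)[OF sp]
  note Hs = herm_subD[OF H]
  show "finite (\<kappa> ` {x \<in> H. P x \<and> h f x / h f f \<in> S})" using Hs(2) by (auto intro!: finite_kappa_sub)
  show "finite (cls r ` S)" using S by (rule finite_cls_subset)
  show "(\<lambda>x. cls r (h f x / h f f)) ` {x \<in> H. P x \<and> h f x / h f f \<in> S} \<subseteq> cls r ` S" by blast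
  show "cls r (h f x / h f f) = cls r (h f y / h f f)"
    if "x \<in> {x \<in> H. P x \<and> h f x / h f f \<in> S}" "y \<in> {x \<in> H. P x \<and> h f x / h f f \<in> S}" "\<kappa> x = \<kappa> y" for x y
  proof -
    have "x - y \<in> D" using that Hs(2) kappa by blast
    then have "x - y \<in> orth H f" using Hs(1) Hs(2)[OF f] h_D by (simp add: orth_def)
    then have "h f (x - y) / h f f \<in> \<P> r" using orth_iff[OF sp, of "x - y"] by (simp add: orth_def)
    then show ?thesis by (simp add: cls_eq_iff h_diff diff_divide_distrib)
  qed
  fix d assume "d \<in> cls r ` S"
  then obtain a where a: "a \<in> S" "d = cls r a" by blast
  have co: "h f (sc a f + w) / h f f = a + h f w / h f f" for w
    using splitsD(6)[OF sp] by (simp add: h_simps add_divide_distrib)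
  have aO: "a \<in> \<O>" using a S by blast
  \<comment> \<open>Vectors of \<open>orth H f\<close> have their coefficient in p^r rather than
    equal to 0, which is why the coefficient of x is prescribed only modulo p^r.\<close>
  have "card (\<kappa> ` {w \<in> orth H f. P (sc a f + w)})
      = card (\<kappa> ` {x \<in> {x \<in> H. P x \<and> h f x / h f f \<in> S}. cls r (h f x / h f f) = d})"
  proof (rule card_image_transfer[where t = "\<lambda>w. sc a f + w"])
    fix w assume w: "w \<in> {w \<in> orth H f. P (sc a f + w)}"
    then have wH: "w \<in> H" and P: "P (sc a f + w)" by (auto simp: orth_def)
    have p: "h f w / h f f \<in> \<P> r" using orth_iff[OF sp wH] w by blast
    have "a + h f w / h f f \<in> S" using sat[OF a(1) O_add[OF aO P_imp_O[OF p]]] p by simp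
    moreover have "sc a f + w \<in> H" using aO wH f by (intro Hs(3) Hs(4))
    moreover have "cls r (a + h f w / h f f) = cls r a" using p by (simp add: cls_eq_iff)
    ultimately show "sc a f + w \<in> {x \<in> {x \<in> H. P x \<and> h f x / h f f \<in> S}. cls r (h f x / h f f) = d}"
      using P by (simp only: co a(2) mem_Collect_eq simp_thms)
  next
    fix y assume y: "y \<in> {x \<in> {x \<in> H. P x \<and> h f x / h f f \<in> S}. cls r (h f x / h f f) = d}"
    then have yH: "y \<in> H" by simp
    have wH: "y - sc a f \<in> H" using yH aO f by (intro herm_sub_diff[OF H] Hs(4))
    have "h f (y - sc a f) / h f f = h f y / h f f - a"
      using splitsD(6)[OF sp] by (simp add: h_simps diff_divide_distrib)
    then have "y - sc a f \<in> orth H f" using y orth_iff[OF sp wH] by (simp add: a cls_eq_iff)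
    then show "\<exists>w\<in>{w \<in> orth H f. P (sc a f + w)}. \<kappa> (sc a f + w) = \<kappa> y"
      using y by (intro bexI[of _ "y - sc a f"]) auto
  next
    fix w w' assume "w \<in> {w \<in> orth H f. P (sc a f + w)}" "w' \<in> {w \<in> orth H f. P (sc a f + w)}"
    then have "w \<in> L" "w' \<in> L" "sc a f + w \<in> L" "sc a f + w' \<in> L"
      using Hs(2,3,4) f aO by (auto simp: orth_def)
    then show "\<kappa> w = \<kappa> w' \<longleftrightarrow> \<kappa> (sc a f + w) = \<kappa> (sc a f + w')" by (simp add: kappa)
  qed
  then show "real (card (\<kappa> ` {x \<in> {x \<in> H. P x \<and> h f x / h f f \<in> S}. cls r (h f x / h f f) = d})) = n"
    using n[OF a(1)] by simp
qed

lemma co_O: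
  assumes "splits H r f" "x \<in> H" shows "h f x / h f f \<in> \<O>"
  using co_iff[OF assms(1), of "h f x" 0] h_pi_r_O[OF assms] by (simp add: P_0)

text \<open>In x = a f + w the multiple a f is killed by \<pi>^i exactly when a lies in p^(r-i), and
  this ideal has q^(2 min(i, r)) classes modulo p^r.\<close>

lemma card_killed_split:
  assumes sp: "splits H r f"
  shows "card (\<kappa> ` killed i H) = q ^ (2 * min i r) * card (\<kappa> ` killed i (orth H f))"
proof -
  note H = splitsD(1)[OF sp] and f = splitsD(4)[OF sp]
  note Hs = herm_subD[OF H]
  have pO: "\<P> (r - i) \<subseteq> \<O>" using P_imp_O by blast
  have kf: "sc (\<pi> ^ i) (sc a f) \<in> D" if "a \<in> \<P> (r - i)" for a
  proof -
    have "\<pi> ^ i * a \<in> \<P> r"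
    proof (cases "i \<le> r")
      case True
      then show ?thesis using P_pi_cancel[of i a "r - i"] that by simp
    next
      case False
      then show ?thesis using P_mono[OF pi_P, of r i] pO that by (intro P_mult_O) auto
    qed
    then have "(\<pi> ^ i * a) / \<pi> ^ r \<in> \<O>" by (simp add: P_iff)
    moreover have "sc (\<pi> ^ r) f \<in> D" using splitsD(2)[OF sp] f by (auto simp: killed_def)
    ultimately have "sc ((\<pi> ^ i * a) / \<pi> ^ r) (sc (\<pi> ^ r) f) \<in> D" by (rule D_scale)
    then show ?thesis by simp
  qed
  have "h f x / h f f \<in> \<P> (r - i)" if "x \<in> killed i H" for x
  proof -
    have x: "x \<in> H" "h f (sc (\<pi> ^ i) x) \<in> \<O>" using that h_D Hs(2)[OF f] by (auto simp: killed_def)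
    then have hi: "\<pi> ^ i * h f x \<in> \<O>" by (simp add: h_scale)
    show ?thesis
    proof (cases "i \<le> r")
      case True
      have "\<pi> ^ (r - i) * (\<pi> ^ i * h f x) \<in> \<P> (r - i)" using hi pi_P by (intro P_mult_O)
      then have "\<pi> ^ r * h f x \<in> \<P> (r - i)" using True by (simp flip: power_add mult.assoc)
      then show ?thesis by (simp add: co_iff[OF sp])
    next
      case False
      then show ?thesis using co_O[OF sp x(1)] by (simp add: P_0)
    qed
  qed
  then have "killed i H = {x \<in> H. sc (\<pi> ^ i) x \<in> D \<and> h f x / h f f \<in> \<P> (r - i)}"
    by (auto simp: killed_def)
  also have "real (card (\<kappa> ` \<dots>)) = real (card (\<kappa> ` killed i (orth H f))) * real (card (cls r ` \<P> (r - i)))"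
  proof (rule split_count[OF sp pO])
    show "b \<in> \<P> (r - i)" if "a \<in> \<P> (r - i)" "b - a \<in> \<P> r" for a b
      using P_add[OF P_mono[OF that(2), of "r - i"] that(1)] by simp
    show "real (card (\<kappa> ` {w \<in> orth H f. sc (\<pi> ^ i) (sc a f + w) \<in> D})) = real (card (\<kappa> ` killed i (orth H f)))"
      if "a \<in> \<P> (r - i)" for a
    proof -
      have "sc (\<pi> ^ i) (sc a f + w) \<in> D \<longleftrightarrow> sc (\<pi> ^ i) w \<in> D" for w
        using D_add[OF kf[OF that], of "sc (\<pi> ^ i) w"] D_diff[OF _ kf[OF that], of "sc (\<pi> ^ i) (sc a f + w)"]
        by (auto simp: vec.scale_right_distrib)
      then show ?thesis by (simp add: killed_def)
    qed
  qed
  also have "\<dots> = real (q ^ (2 * min i r) * card (\<kappa> ` killed i (orth H f)))"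
    by (simp add: card_cls_P min_def)
  finally show ?thesis by linarith
qed

section \<open>Distribution of the norm values\<close>

lemma card_nrm_units:
  assumes H: "herm_sub H" "H = killed r H" and s: "1 \<le> s" "s \<le> r" and u: "u \<in> sym_units"
  shows "real (card (\<kappa> ` {x \<in> H. nrm r x \<in> units}))
    = real (card (\<kappa> ` {x \<in> H. nrm r x - u \<in> \<P> s})) * (real q ^ s - real q ^ (s - 1))"
proof -
  note Hs = herm_subD[OF H(1)]
  have "real (card (\<kappa> ` {x \<in> H. nrm r x \<in> units}))
    = real (card (\<kappa> ` {x \<in> H. nrm r x - u \<in> \<P> s})) * real (card (cls s ` sym_units))"
  proof (rule card_image_fibres[where m = "\<lambda>x. cls s (nrm r x)"])
    show "finite (\<kappa> ` {x \<in> H. nrm r x \<in> units})" using Hs(2) by (auto intro!: finite_kappa_sub)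
    show "finite (cls s ` sym_units)" using sym_units_sub(1) by (rule finite_cls_subset)
    show "(\<lambda>x. cls s (nrm r x)) ` {x \<in> H. nrm r x \<in> units} \<subseteq> cls s ` sym_units"
      by (auto simp: sym_units_def star_nrm)
    show "cls s (nrm r x) = cls s (nrm r y)"
      if "x \<in> {x \<in> H. nrm r x \<in> units}" "y \<in> {x \<in> H. nrm r x \<in> units}" "\<kappa> x = \<kappa> y" for x y
    proof -
      have "x \<in> L" "y \<in> L" "x - y \<in> D" using that Hs(2) kappa by blast+
      from P_mono[OF nrm_cong[OF this] s(2)] show ?thesis by (simp add: cls_eq_iff)
    qed
    fix d assume "d \<in> cls s ` sym_units"
    then obtain u' where u': "u' \<in> sym_units" "d = cls s u'" by blast
    have "u' / u \<in> sym_units" using u u' by (simp add: sym_units_def units_divide star_divide)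
    \<comment> \<open>Scaling by an element of norm u'/u modulo p^s carries vectors of norm u to
      vectors of norm u', so all fixed unit values occur equally often.\<close>
    then obtain a where a: "a \<in> units" "a * star a - u' / u \<in> \<P> s" using norm_surj[OF s(1)] by blast
    have "u * (a * star a - u' / u) \<in> \<P> s" using a(2) u by (intro P_mult_O) (auto simp: sym_units_def units_imp_O)
    then have au: "a * star a * u - u' \<in> \<P> s"
      using units_nonzero[of u] u by (simp add: sym_units_def algebra_simps)
    have aa: "a * star a \<in> units" using a(1) by (simp add: units_mult)
    have key: "nrm r x - u \<in> \<P> s \<longleftrightarrow> nrm r (sc a x) - u' \<in> \<P> s" for x
    proof -
      have "nrm r (sc a x) - u' = a * star a * (nrm r x - u) + (a * star a * u - u')"
        by (simp add: nrm_def h_simps algebra_simps)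
      then have "nrm r (sc a x) - u' \<in> \<P> s \<longleftrightarrow> a * star a * (nrm r x - u) \<in> \<P> s"
        using P_add[OF _ au, of "a * star a * (nrm r x - u)"] P_diff[OF _ au, of "nrm r (sc a x) - u'"]
        by (metis add_diff_cancel_right')
      then show ?thesis using P_cancel_unit[OF aa] by blast
    qed
    have set_eq: "{x \<in> {x \<in> H. nrm r x \<in> units}. cls s (nrm r x) = d} = {x \<in> H. nrm r x - u' \<in> \<P> s}"
    proof -
      have "nrm r x \<in> units" if "nrm r x - u' \<in> \<P> s" for x
        using P_mono[OF that s(1)] u' units_cong[of u' "nrm r x"] by (simp add: sym_units_def)
      then show ?thesis by (auto simp: u' cls_eq_iff)
    qed
    have "card (\<kappa> ` {x \<in> H. nrm r x - u \<in> \<P> s}) = card (\<kappa> ` {x \<in> H. nrm r x - u' \<in> \<P> s})"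
    proof (rule card_image_transfer[where t = "sc a"])
      show "sc a x \<in> {x \<in> H. nrm r x - u' \<in> \<P> s}" if "x \<in> {x \<in> H. nrm r x - u \<in> \<P> s}" for x
        using that key[of x] a Hs(4) by (auto simp: units_imp_O)
      show "\<exists>x\<in>{x \<in> H. nrm r x - u \<in> \<P> s}. \<kappa> (sc a x) = \<kappa> y" if "y \<in> {x \<in> H. nrm r x - u' \<in> \<P> s}" for y
      proof -
        have "sc a (sc (inverse a) y) = y" using units_nonzero[OF a(1)] by simp
        moreover have "sc (inverse a) y \<in> H" using that a(1) units_inverse Hs(4) by (auto simp: units_imp_O)
        ultimately show ?thesis using that key[of "sc (inverse a) y"] by (intro bexI[of _ "sc (inverse a) y"]) auto
      qed
      fix x y assume "x \<in> {x \<in> H. nrm r x - u \<in> \<P> s}" "y \<in> {x \<in> H. nrm r x - u \<in> \<P> s}"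
      then have xy: "x \<in> L" "y \<in> L" "sc a x \<in> L" "sc a y \<in> L" using Hs(2,4) a(1) units_imp_O by auto
      have "sc a x - sc a y \<in> D \<longleftrightarrow> x - y \<in> D"
      proof
        assume "sc a x - sc a y \<in> D"
        then have "sc (inverse a) (sc a x - sc a y) \<in> D"
          using a(1) units_inverse by (intro D_scale) (auto simp: units_imp_O)
        then show "x - y \<in> D" using units_nonzero[OF a(1)] by (simp add: vec.scale_right_diff_distrib)
      next
        assume "x - y \<in> D"
        then have "sc a (x - y) \<in> D" using a(1) by (intro D_scale) (auto simp: units_imp_O)
        then show "sc a x - sc a y \<in> D" by (simp add: vec.scale_right_diff_distrib)
      qed
      then show "\<kappa> x = \<kappa> y \<longleftrightarrow> \<kappa> (sc a x) = \<kappa> (sc a y)" using xy by (simp add: kappa)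
    qed
    then show "real (card (\<kappa> ` {x \<in> {x \<in> H. nrm r x \<in> units}. cls s (nrm r x) = d}))
        = real (card (\<kappa> ` {x \<in> H. nrm r x - u \<in> \<P> s}))"
      by (simp only: set_eq)
  qed
  moreover have "real (card (cls s ` sym_units)) = real q ^ s - real q ^ (s - 1)"
    using card_cls_sym_units[OF s(1)] by (simp flip: of_nat_power of_nat_add)
  ultimately show ?thesis by simp
qed

lemma card_nrm_partition:
  assumes H: "herm_sub H" "H = killed r H" and r: "1 \<le> r"
  shows "card (\<kappa> ` H) = card (\<kappa> ` {x \<in> H. nrm r x \<in> \<P> 1}) + card (\<kappa> ` {x \<in> H. nrm r x \<in> units})"
proof -
  note Hs = herm_subD[OF H(1)]
  have "\<kappa> ` H = \<kappa> ` {x \<in> H. nrm r x \<in> \<P> 1} \<union> \<kappa> ` {x \<in> H. nrm r x \<in> units}"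
    using nrm_O[OF H] by (auto simp: units_def)
  moreover have "\<kappa> ` {x \<in> H. nrm r x \<in> \<P> 1} \<inter> \<kappa> ` {x \<in> H. nrm r x \<in> units} = {}"
  proof -
    have False if "x \<in> H" "y \<in> H" "nrm r x \<in> \<P> 1" "nrm r y \<in> units" "\<kappa> x = \<kappa> y" for x y
    proof -
      have "y - x \<in> D" "x \<in> L" "y \<in> L" using that Hs(2) kappa[of y x] by auto
      then have "nrm r y - nrm r x \<in> \<P> 1" using P_mono[OF nrm_cong r] by blast
      from P_add[OF this that(3)] that(4) show False by (simp add: units_def)
    qed
    then show ?thesis by blast
  qed
  moreover have "finite (\<kappa> ` {x \<in> H. nrm r x \<in> \<P> 1})" "finite (\<kappa> ` {x \<in> H. nrm r x \<in> units})"
    using Hs(2) by (auto intro!: finite_kappa_sub)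
  ultimately show ?thesis by (simp add: card_Un_disjoint)
qed

text \<open>Polarization: a nondegenerate form whose norms all lose a factor of \<open>\<pi>\<close> does so everywhere.\<close>

lemma exists_unit_nrm:
  assumes H: "herm_sub H" "H = killed r H" and r: "1 \<le> r" and ne: "H \<noteq> killed (r - 1) H"
  shows "\<exists>f. splits H r f"
proof (rule ccontr)
  assume none: "\<not> ?thesis"
  note Hs = herm_subD[OF H(1)]
  have n: "nrm r x \<in> \<P> 1" if "x \<in> H" for x
    using none that nrm_O[OF H that] H r unfolding splits_def units_def by blast
  obtain \<theta> where th: "\<theta> \<in> \<O>" "\<theta> - star \<theta> \<in> units" using ex_unit_star_diff by blast
  have tr: "\<pi> ^ r * h x y + \<pi> ^ r * h y x \<in> \<P> 1" if "x \<in> H" "y \<in> H" for x y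
  proof -
    have "nrm r (x + y) - nrm r x - nrm r y \<in> \<P> 1" using that n Hs(3) by (intro P_diff) auto
    then show ?thesis by (simp add: nrm_def h_simps algebra_simps)
  qed
  \<comment> \<open>Both h x y and h x (\<theta> y), multiplied by \<pi>^r, have trace in p.
    Eliminating h y x leaves \<theta> - \<open>star\<close> \<theta> times \<pi>^r h x y.\<close>
  have hP: "\<pi> ^ r * h x y \<in> \<P> 1" if xy: "x \<in> H" "y \<in> H" for x y
  proof -
    have "\<pi> ^ r * (\<theta> * h x y) + \<pi> ^ r * (star \<theta> * h y x) \<in> \<P> 1"
      using tr[OF xy(1) Hs(4)[OF th(1) xy(2)]] by (simp add: h_simps)
    moreover have "(\<pi> ^ r * h x y + \<pi> ^ r * h y x) * star \<theta> \<in> \<P> 1"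
      using tr[OF xy] th by (intro P_mult_O) auto
    ultimately have "(\<pi> ^ r * (\<theta> * h x y) + \<pi> ^ r * (star \<theta> * h y x))
        - (\<pi> ^ r * h x y + \<pi> ^ r * h y x) * star \<theta> \<in> \<P> 1" by (rule P_diff)
    then have "(\<theta> - star \<theta>) * (\<pi> ^ r * h x y) \<in> \<P> 1" by (simp add: algebra_simps)
    then show ?thesis using P_cancel_unit[OF th(2)] by blast
  qed
  have "x \<in> killed (r - 1) H" if x: "x \<in> H" for x
  proof -
    have "sc (\<pi> ^ (r - 1)) x \<in> D"
    proof (rule Hs(5))
      show "sc (\<pi> ^ (r - 1)) x \<in> H" using x pi_O by (intro Hs(4))
      fix y assume "y \<in> H"
      then have "\<pi> ^ r * h x y \<in> \<P> 1" using hP x by blast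
      moreover have "\<pi> ^ r = \<pi> * \<pi> ^ (r - 1)" using r by (cases r) auto
      ultimately show "h (sc (\<pi> ^ (r - 1)) x) y \<in> \<O>"
        using P_pi_cancel[of 1 "\<pi> ^ (r - 1) * h x y" 0] by (simp add: h_simps star_power P_0 mult.assoc)
    qed
    then show ?thesis using x by (simp add: killed_def)
  qed
  then show False using ne by (auto simp: killed_def)
qed

lemma killed_orth: "H = killed r H \<Longrightarrow> orth H f = killed r (orth H f)"
  by (auto simp: killed_def orth_def)

text \<open>The exponent m counts the summands of exact exponent r. Here r stays fixed during the
  induction, so the base case is a module already killed by \<pi>^(r-1), where every
  \<open>nrm r x\<close> is divisible by \<pi>.\<close>

lemma card_isotropic:
  assumes "herm_sub H" "H = killed r H" "1 \<le> r"
    and "card (\<kappa> ` H) = q ^ (2 * m) * card (\<kappa> ` killed (r - 1) H)"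
  shows "real (card (\<kappa> ` {x \<in> H. nrm r x \<in> \<P> 1}))
    = real (card (\<kappa> ` H)) * (1 / real q + (1 - 1 / real q) * (- (1 / real q)) ^ m)"
  using assms
proof (induction m arbitrary: H)
  case 0
  note Hs = herm_subD[OF 0(1)]
  have sub: "\<kappa> ` killed (r - 1) H \<subseteq> \<kappa> ` H" by (auto simp: killed_def)
  have fin: "finite (\<kappa> ` H)" using Hs(2) by (auto intro!: finite_kappa_sub)
  have eq: "\<kappa> ` killed (r - 1) H = \<kappa> ` H" using card_subset_eq[OF fin sub] 0(4) by simp
  have "nrm r x \<in> \<P> 1" if "x \<in> H" for x
  proof -
    have "\<kappa> x \<in> \<kappa> ` killed (r - 1) H" unfolding eq using that by blast
    then obtain y where y: "y \<in> H" "sc (\<pi> ^ (r - 1)) y \<in> D" "\<kappa> x = \<kappa> y" by (auto simp: killed_def)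
    then have "x \<in> L" "y \<in> L" "x - y \<in> D" using that Hs(2) kappa by blast+
    then have d: "nrm r x - nrm r y \<in> \<P> 1" using P_mono[OF nrm_cong 0(3)] by blast
    have "h y (sc (\<pi> ^ (r - 1)) y) \<in> \<O>" using h_D y \<open>y \<in> L\<close> by blast
    then have "\<pi> ^ 1 * (\<pi> ^ (r - 1) * h y y) \<in> \<P> (1 + 0)" unfolding P_pi_cancel P_0 by (simp add: h_scale)
    then have "nrm r y \<in> \<P> 1" using 0(3) by (cases r) (auto simp: nrm_def mult.assoc)
    from P_add[OF d this] show ?thesis by simp
  qed
  then have "{x \<in> H. nrm r x \<in> \<P> 1} = H" by blast
  then show ?case using q_gt_1 by simp
next
  case (Suc m)
  note H = Suc.prems(1,2) and r = Suc.prems(3)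
  note Hs = herm_subD[OF H(1)]
  define Q where "Q = real q"
  have Q: "Q > 1" using q_gt_1 by (simp add: Q_def)
  have fin: "finite (\<kappa> ` S)" if "S \<subseteq> H" for S using Hs(2) that by (intro finite_kappa_sub) auto
  have "0 \<in> H" using D_zero Hs(1) by blast
  then have pos: "card (\<kappa> ` H) > 0" using fin[OF order_refl] card_gt_0_iff by blast
  have "H \<noteq> killed (r - 1) H"
  proof
    assume "H = killed (r - 1) H"
    then have "1 * card (\<kappa> ` H) = q ^ (2 * Suc m) * card (\<kappa> ` H)" using Suc.prems(4) by simp
    then have "q ^ (2 * Suc m) = 1"
      using pos mult_cancel2[of 1 "card (\<kappa> ` H)" "q ^ (2 * Suc m)"] by linarith
    moreover have "1 < q ^ (2 * Suc m)" using q_gt_1 by (rule one_less_power) simp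
    ultimately show False by linarith
  qed
  then obtain f where sp: "splits H r f" using exists_unit_nrm[OF H r] by blast
  define H' where "H' = orth H f"
  have H': "herm_sub H'" "H' = killed r H'"
    using herm_sub_orth[OF sp] killed_orth[OF H(2)] by (simp_all add: H'_def)
  have cH: "card (\<kappa> ` H) = q ^ (2 * r) * card (\<kappa> ` H')"
    using card_killed_split[OF sp, of r] H(2) H'(2) by (simp add: H'_def)
  have ck: "card (\<kappa> ` killed (r - 1) H) = q ^ (2 * (r - 1)) * card (\<kappa> ` killed (r - 1) H')"
    using card_killed_split[OF sp, of "r - 1"] by (simp add: H'_def min_def)
  have r2: "q ^ (2 * r) = q ^ 2 * q ^ (2 * (r - 1))" using r by (cases r) (auto simp: power2_eq_square)
  have "q ^ (2 * r) * card (\<kappa> ` H') = q ^ (2 * Suc m) * (q ^ (2 * (r - 1)) * card (\<kappa> ` killed (r - 1) H'))"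
    using Suc.prems(4) by (simp only: cH ck)
  then have "(q ^ 2 * q ^ (2 * (r - 1))) * card (\<kappa> ` H') = (q ^ 2 * q ^ (2 * (r - 1))) * (q ^ (2 * m) * card (\<kappa> ` killed (r - 1) H'))"
    by (simp only: r2) (simp add: power2_eq_square mult_ac)
  then have "card (\<kappa> ` H') = q ^ (2 * m) * card (\<kappa> ` killed (r - 1) H')" using q_gt_1 by simp
  from Suc.IH[OF H' r this]
  have IH: "real (card (\<kappa> ` {x \<in> H'. nrm r x \<in> \<P> 1}))
    = real (card (\<kappa> ` H')) * (1 / Q + (1 - 1 / Q) * (- (1 / Q)) ^ m)" by (simp add: Q_def)
  \<comment> \<open>By equidistribution each of the q - 1 nonzero fixed residues modulo p is the
    norm of the same number E of vectors of \<open>H'\<close>.\<close>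
  define E where "E = (real (card (\<kappa> ` H')) - real (card (\<kappa> ` {x \<in> H'. nrm r x \<in> \<P> 1}))) / (Q - 1)"
  have E: "real (card (\<kappa> ` {w \<in> H'. nrm r w - u \<in> \<P> 1})) = E" if "u \<in> sym_units" for u
    using card_nrm_units[OF H' order_refl r that] card_nrm_partition[OF H' r] Q
    by (simp add: E_def Q_def field_simps)
  \<comment> \<open>The mixed terms vanish modulo p because \<open>h f w\<close> is
    integral.\<close>
  have nrm_split: "nrm r (sc a f + w) - (a * star a * nrm r f + nrm r w) \<in> \<P> 1"
    if "a \<in> \<O>" "w \<in> H'" for a w
  proof -
    have "h f w \<in> \<O>" "h w f \<in> \<O>" using that h_O_commute by (auto simp: H'_def orth_def)
    then have "\<pi> ^ r * (star a * h f w + a * h w f) \<in> \<P> r"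
      using that by (intro P_mult_O pi_P O_add O_mult) auto
    from P_mono[OF this r] show ?thesis by (simp add: nrm_def h_simps algebra_simps)
  qed
  have cong: "x \<in> \<P> 1 \<longleftrightarrow> y \<in> \<P> 1" if "x - y \<in> \<P> 1" for x y
    using P_add[OF that, of y] P_diff[OF _ that, of x] by auto
  have nf: "nrm r f \<in> units" by (rule splitsD(5)[OF sp])
  have c1: "real (card (\<kappa> ` {x \<in> H. nrm r x \<in> \<P> 1 \<and> h f x / h f f \<in> \<P> 1}))
      = real (card (\<kappa> ` {x \<in> H'. nrm r x \<in> \<P> 1})) * real (card (cls r ` \<P> 1))"
  proof (rule split_count[OF sp])
    show "\<P> 1 \<subseteq> \<O>" using P_imp_O by blast
    show "b \<in> \<P> 1" if "a \<in> \<P> 1" "b - a \<in> \<P> r" for a b using cong[OF P_mono[OF that(2) r]] that(1) by blast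
    show "real (card (\<kappa> ` {w \<in> orth H f. nrm r (sc a f + w) \<in> \<P> 1})) = real (card (\<kappa> ` {x \<in> H'. nrm r x \<in> \<P> 1}))"
      if a: "a \<in> \<P> 1" for a
    proof -
      have "nrm r (sc a f + w) \<in> \<P> 1 \<longleftrightarrow> nrm r w \<in> \<P> 1" if "w \<in> H'" for w
      proof -
        have "a * star a * nrm r f \<in> \<P> 1" using a nf P_imp_O[OF a] by (intro P_mult_O(1)) (auto simp: units_imp_O)
        then have "(a * star a * nrm r f + nrm r w) - nrm r w \<in> \<P> 1" by simp
        from cong[OF this] cong[OF nrm_split[OF P_imp_O[OF a] that]] show ?thesis by blast
      qed
      then have "{w \<in> orth H f. nrm r (sc a f + w) \<in> \<P> 1} = {x \<in> H'. nrm r x \<in> \<P> 1}"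
        by (auto simp: H'_def)
      then show ?thesis by simp
    qed
  qed
  \<comment> \<open>For a unit coefficient a the norm of w is forced modulo p to be
    \<open>- (a * star a * nrm r f)\<close>, a fixed unit, which leaves E choices of w.\<close>
  have c2: "real (card (\<kappa> ` {x \<in> H. nrm r x \<in> \<P> 1 \<and> h f x / h f f \<in> units})) = E * real (card (cls r ` units))"
  proof (rule split_count[OF sp])
    show "units \<subseteq> \<O>" by (rule sym_units_sub)
    show "b \<in> units" if "a \<in> units" "b - a \<in> \<P> r" for a b
      using units_cong[OF that(1) P_mono[OF that(2) r]] .
    show "real (card (\<kappa> ` {w \<in> orth H f. nrm r (sc a f + w) \<in> \<P> 1})) = E" if a: "a \<in> units" for a
    proof -
      let ?u = "- (a * star a * nrm r f)"
      have u: "?u \<in> sym_units" using a nf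
        by (simp add: sym_units_def units_minus units_mult star_minus star_mult star_nrm star_star mult_ac)
      have "nrm r (sc a f + w) \<in> \<P> 1 \<longleftrightarrow> nrm r w - ?u \<in> \<P> 1" if "w \<in> H'" for w
        using cong[OF nrm_split[OF units_imp_O[OF a] that]] by (simp add: add.commute)
      then have "{w \<in> orth H f. nrm r (sc a f + w) \<in> \<P> 1} = {w \<in> H'. nrm r w - ?u \<in> \<P> 1}"
        by (auto simp: H'_def)
      then show ?thesis using E[OF u] by simp
    qed
  qed
  have "\<kappa> ` {x \<in> H. nrm r x \<in> \<P> 1} = \<kappa> ` {x \<in> H. nrm r x \<in> \<P> 1 \<and> h f x / h f f \<in> \<P> 1}
      \<union> \<kappa> ` {x \<in> H. nrm r x \<in> \<P> 1 \<and> h f x / h f f \<in> units}"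
    using co_O[OF sp] by (auto simp: units_def)
  moreover have "\<kappa> ` {x \<in> H. nrm r x \<in> \<P> 1 \<and> h f x / h f f \<in> \<P> 1}
      \<inter> \<kappa> ` {x \<in> H. nrm r x \<in> \<P> 1 \<and> h f x / h f f \<in> units} = {}"
  proof -
    have False if "x \<in> H" "y \<in> H" "h f x / h f f \<in> \<P> 1" "h f y / h f f \<in> units" "\<kappa> x = \<kappa> y" for x y
    proof -
      have "x - y \<in> D" using that Hs(2) kappa by blast
      then have "x - y \<in> orth H f" using Hs(1) Hs(2)[OF splitsD(4)[OF sp]] h_D by (simp add: orth_def)
      then have "h f (x - y) / h f f \<in> \<P> r" using orth_iff[OF sp, of "x - y"] by (simp add: orth_def)
      from P_mono[OF this r] have "h f x / h f f - h f y / h f f \<in> \<P> 1" by (simp add: h_diff diff_divide_distrib)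
      from cong[OF this] that(3,4) show False by (simp add: units_def)
    qed
    then show ?thesis by blast
  qed
  moreover have "finite (\<kappa> ` {x \<in> H. nrm r x \<in> \<P> 1 \<and> h f x / h f f \<in> \<P> 1})"
    "finite (\<kappa> ` {x \<in> H. nrm r x \<in> \<P> 1 \<and> h f x / h f f \<in> units})" by (auto intro!: fin)
  ultimately have total: "real (card (\<kappa> ` {x \<in> H. nrm r x \<in> \<P> 1}))
      = real (card (\<kappa> ` {x \<in> H'. nrm r x \<in> \<P> 1})) * real (card (cls r ` \<P> 1)) + E * real (card (cls r ` units))"
    using c1 c2 by (simp add: card_Un_disjoint)
  have cP: "real (card (cls r ` \<P> 1)) = Q ^ (2 * (r - 1))" by (simp add: card_cls_P Q_def)
  have cU: "real (card (cls r ` units)) = Q ^ (2 * (r - 1)) * (Q ^ 2 - 1)"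
  proof -
    have "real (card (cls r ` units)) + Q ^ (2 * (r - 1)) = real (q ^ (2 * r))"
      unfolding Q_def card_cls_units[OF r, symmetric] by simp
    also have "\<dots> = Q ^ 2 * Q ^ (2 * (r - 1))" unfolding r2 Q_def by simp
    finally show ?thesis by (simp add: algebra_simps)
  qed
  have cH': "real (card (\<kappa> ` H)) = Q ^ 2 * Q ^ (2 * (r - 1)) * real (card (\<kappa> ` H'))"
    unfolding cH r2 Q_def by simp
  have alg1: "A * I + E * (A * (Q ^ 2 - 1)) = A * (I + (Q + 1) * (N - I))"
    if "E = (N - I) / (Q - 1)" for A I N
  proof -
    have "E * (Q - 1) = N - I" using that Q by simp
    moreover have "E * (A * (Q ^ 2 - 1)) = A * ((Q + 1) * (E * (Q - 1)))"
      by (simp add: power2_eq_square algebra_simps)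
    ultimately show ?thesis by (simp add: distrib_left)
  qed
  \<comment> \<open>For p = 1/Q + (1 - 1/Q) y the recursion sends p to (p + (Q + 1)(1 - p))/Q^2,
    which amounts to multiplying y by -1/Q.\<close>
  have alg2: "A * (N * (1 / Q + (1 - 1 / Q) * y) + (Q + 1) * (N - N * (1 / Q + (1 - 1 / Q) * y)))
      = Q ^ 2 * A * N * (1 / Q + (1 - 1 / Q) * ((- (1 / Q)) * y))" for A N y
    using Q by (simp add: power2_eq_square field_simps)
  have "real (card (\<kappa> ` {x \<in> H. nrm r x \<in> \<P> 1}))
      = Q ^ (2 * (r - 1)) * real (card (\<kappa> ` {x \<in> H'. nrm r x \<in> \<P> 1})) + E * (Q ^ (2 * (r - 1)) * (Q ^ 2 - 1))"
    unfolding total cP cU by (simp only: mult.commute)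
  also have "\<dots> = Q ^ (2 * (r - 1)) * (real (card (\<kappa> ` {x \<in> H'. nrm r x \<in> \<P> 1}))
      + (Q + 1) * (real (card (\<kappa> ` H')) - real (card (\<kappa> ` {x \<in> H'. nrm r x \<in> \<P> 1}))))"
    by (rule alg1[OF E_def])
  also have "\<dots> = Q ^ 2 * Q ^ (2 * (r - 1)) * real (card (\<kappa> ` H')) * (1 / Q + (1 - 1 / Q) * ((- (1 / Q)) * (- (1 / Q)) ^ m))"
    unfolding IH by (rule alg2)
  finally show ?case by (simp only: cH' power_Suc Q_def)
qed

text \<open>The vectors of unit norm are the complement of those in \<open>card_isotropic\<close>.
  They are spread evenly over q^r - q^(r-1) values modulo p^r, one of which is 1, and the factor 1 -
  1/q cancels.\<close>

lemma card_unit_vectors: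
  assumes H: "herm_sub H" "H = killed r H" and r: "1 \<le> r"
    and m: "card (\<kappa> ` H) = q ^ (2 * m) * card (\<kappa> ` killed (r - 1) H)"
  shows "real (card (\<kappa> ` {x \<in> H. h x x - inverse (\<pi> ^ r) \<in> \<O>}))
    = real (card (\<kappa> ` H)) / real q ^ r * (1 - (- (1 / real q)) ^ m)"
proof -
  define Q where "Q = real q"
  have Q: "Q > 1" using q_gt_1 by (simp add: Q_def)
  have "h x x - inverse (\<pi> ^ r) \<in> \<O> \<longleftrightarrow> nrm r x - 1 \<in> \<P> r" for x
    using P_pi_cancel[of r "h x x - inverse (\<pi> ^ r)" 0] by (simp add: nrm_def P_0 right_diff_distrib)
  then have eq: "{x \<in> H. h x x - inverse (\<pi> ^ r) \<in> \<O>} = {x \<in> H. nrm r x - 1 \<in> \<P> r}" by simp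
  have "1 \<in> sym_units" by (simp add: sym_units_def)
  note unit = card_nrm_units[OF H r order_refl this]
  have "real (card (\<kappa> ` H)) = real (card (\<kappa> ` {x \<in> H. nrm r x \<in> \<P> 1}))
      + real (card (\<kappa> ` {x \<in> H. nrm r x \<in> units}))"
    by (simp only: card_nrm_partition[OF H r] of_nat_add)
  with unit card_isotropic[OF H r m]
  have "real (card (\<kappa> ` {x \<in> H. nrm r x - 1 \<in> \<P> r})) * (Q ^ r - Q ^ (r - 1))
      = real (card (\<kappa> ` H)) - real (card (\<kappa> ` H)) * (1 / Q + (1 - 1 / Q) * (- (1 / Q)) ^ m)"
    unfolding Q_def by linarith
  also have "\<dots> = real (card (\<kappa> ` H)) * ((1 - 1 / Q) * (1 - (- (1 / Q)) ^ m))"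
    by (simp add: algebra_simps)
  also have "Q ^ r - Q ^ (r - 1) = Q ^ r * (1 - 1 / Q)" using r Q by (cases r) (auto simp: field_simps)
  finally have "(real (card (\<kappa> ` {x \<in> H. nrm r x - 1 \<in> \<P> r})) * Q ^ r) * (1 - 1 / Q)
      = (real (card (\<kappa> ` H)) * (1 - (- (1 / Q)) ^ m)) * (1 - 1 / Q)" by (simp only: mult_ac)
  then have "real (card (\<kappa> ` {x \<in> H. nrm r x - 1 \<in> \<P> r})) * Q ^ r
      = real (card (\<kappa> ` H)) * (1 - (- (1 / Q)) ^ m)"
    using Q by (subst (asm) mult_cancel_right) auto
  then show ?thesis unfolding eq Q_def[symmetric] using Q by (simp add: field_simps)
qed

section \<open>Orthogonal frames\<close>

definition frame_set :: "'b set \<Rightarrow> nat list \<Rightarrow> 'b list set" where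
  "frame_set H rs = {fs. set fs \<subseteq> H \<and>
     list_all2 (\<lambda>r f. sc (\<pi> ^ r) f \<in> D \<and> h f f - inverse (\<pi> ^ r) \<in> \<O>) rs fs \<and>
     sorted_wrt (\<lambda>f g. h f g \<in> \<O>) fs}"

text \<open>Orthogonality is imposed only on earlier against later entries, so removing the first
  vector leaves a frame of its complement. This permits induction on the list.\<close>

lemma frame_set_Cons:
  assumes "f \<in> H" "H = killed r H" "h f f - inverse (\<pi> ^ r) \<in> \<O>"
  shows "f # fs \<in> frame_set H (r # rs) \<longleftrightarrow> fs \<in> frame_set (orth H f) rs"
proof -
  have "f \<in> killed r H" using assms(1,2) by blast
  then have "sc (\<pi> ^ r) f \<in> D" by (simp add: killed_def)
  then show ?thesis using assms(1,3) by (auto simp: frame_set_def orth_def)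
qed

text \<open>A module of type r # rs with r largest has q^(2r + 2 |rs|) elements; the fraction q^(-r)
  (1 - (-1/q)^m) of them has norm \<pi>^(-r), where m is the multiplicity of r.\<close>

primrec frame_count :: "nat list \<Rightarrow> real" where
  "frame_count [] = 1"
| "frame_count (r # rs) = real q ^ (r + 2 * sum_list rs)
     * (1 - (- (1 / real q)) ^ count_list (r # rs) r) * frame_count rs"

text \<open>Lowering the cap from r to r - 1 costs one for each part equal to r. This identifies the
  exponent m of \<open>card_unit_vectors\<close> with the multiplicity of r.\<close>

lemma sum_min_pred:
  "1 \<le> r \<Longrightarrow> \<forall>l\<in>set rs. l \<le> r \<Longrightarrow>
    (\<Sum>j\<leftarrow>rs. min r j) = count_list rs r + (\<Sum>j\<leftarrow>rs. min (r - 1) j)"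
proof (induction rs)
  case (Cons a rs)
  then have IH: "(\<Sum>j\<leftarrow>rs. min r j) = count_list rs r + (\<Sum>j\<leftarrow>rs. min (r - 1) j)" by simp
  show ?case using Cons.prems by (cases "a = r") (auto simp: IH min_def[of r a] min_def[of "r - Suc 0" a])
qed simp

text \<open>The type enters only through the cardinalities of the H[\<pi>^i], a hypothesis that
  passes to the complement of the first vector by \<open>card_killed_split\<close>.\<close>

lemma card_frames:
  assumes "herm_sub H" "sorted_wrt (\<ge>) rs" "\<forall>l\<in>set rs. 1 \<le> l"
    and "\<And>i. card (\<kappa> ` killed i H) = q ^ (2 * (\<Sum>j\<leftarrow>rs. min i j))"
  shows "real (card (map \<kappa> ` frame_set H rs)) = frame_count rs"
  using assms
proof (induction rs arbitrary: H)
  case Nil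
  have "frame_set H [] = {[]}" by (auto simp: frame_set_def)
  then show ?case by simp
next
  case (Cons r rs)
  note H = Cons.prems(1) and cards = Cons.prems(4)
  note Hs = herm_subD[OF H]
  have r: "1 \<le> r" and le: "\<forall>l\<in>set (r # rs). l \<le> r" using Cons.prems by auto
  have fin: "finite (\<kappa> ` S)" if "S \<subseteq> H" for S using Hs(2) that by (intro finite_kappa_sub) auto
  have sum_min: "(\<Sum>j\<leftarrow>r # rs. min k j) = sum_list (r # rs)" if "r \<le> k" for k
    using le that by (intro arg_cong[of _ _ sum_list] map_idI) auto
  \<comment> \<open>The exponent is recovered from cardinalities: they stop growing at i = r, while
    each x is killed by some power of \<pi>.\<close>
  have kH: "H = killed r H"
  proof -
    have "x \<in> killed r H" if x: "x \<in> H" for x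
    proof -
      obtain k where k: "sc (\<pi> ^ k) x \<in> D" using torsion Hs(2)[OF x] by blast
      have xk: "x \<in> killed (r + k) H" using D_scale[OF pi_O k, of r] x by (simp add: killed_def power_add)
      have sub: "\<kappa> ` killed r H \<subseteq> \<kappa> ` killed (r + k) H"
        using D_scale[OF pi_O, of "sc (\<pi> ^ r) _" k] by (auto simp: killed_def power_add mult.commute)
      have f: "finite (\<kappa> ` killed (r + k) H)" by (rule fin) (auto simp: killed_def)
      have "card (\<kappa> ` killed r H) = card (\<kappa> ` killed (r + k) H)"
        unfolding cards using sum_min[of r] sum_min[of "r + k"] by simp
      from card_subset_eq[OF f sub this] xk have "\<kappa> x \<in> \<kappa> ` killed r H" by blast
      then obtain y where y: "y \<in> H" "sc (\<pi> ^ r) y \<in> D" "\<kappa> x = \<kappa> y" by (auto simp: killed_def)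
      then have "x - y \<in> D" using kappa x Hs(2) by blast
      from D_add[OF D_scale[OF pi_O this, of r] y(2)] have "sc (\<pi> ^ r) x \<in> D"
        by (simp add: vec.scale_right_diff_distrib)
      with x show ?thesis by (simp add: killed_def)
    qed
    then show ?thesis by (auto simp: killed_def)
  qed
  have cH: "card (\<kappa> ` H) = q ^ (2 * sum_list (r # rs))"
    using cards[of r] sum_min[of r] kH by simp
  let ?m = "count_list (r # rs) r"
  have "card (\<kappa> ` H) = q ^ (2 * ?m) * card (\<kappa> ` killed (r - 1) H)"
    using cards[of r] sum_min_pred[OF r le] kH cards[of "r - 1"]
    by (simp only: distrib_left power_add) 
  note unit_card = card_unit_vectors[OF H kH r this]
  let ?U = "{x \<in> H. h x x - inverse (\<pi> ^ r) \<in> \<O>}"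
  have "real (card (map \<kappa> ` frame_set H (r # rs))) = frame_count rs * real (card (\<kappa> ` ?U))"
  proof (rule card_image_fibres[where m = "\<lambda>fs. \<kappa> (hd fs)"])
    have "map \<kappa> ` frame_set H (r # rs) \<subseteq> {xs. set xs \<subseteq> \<kappa> ` L \<and> length xs = length (r # rs)}"
      using Hs(2) by (fastforce simp: frame_set_def dest: list_all2_lengthD)
    then show "finite (map \<kappa> ` frame_set H (r # rs))"
      by (rule finite_subset) (rule finite_lists_length_eq[OF finite_kappa])
    show "finite (\<kappa> ` ?U)" by (rule fin) auto
    show "(\<lambda>fs. \<kappa> (hd fs)) ` frame_set H (r # rs) \<subseteq> \<kappa> ` ?U"
      by (auto simp: frame_set_def list_all2_Cons1)
    show "\<kappa> (hd fs) = \<kappa> (hd gs)"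
      if "fs \<in> frame_set H (r # rs)" "gs \<in> frame_set H (r # rs)" "map \<kappa> fs = map \<kappa> gs" for fs gs
      using that by (auto simp: frame_set_def list_all2_Cons1)
    fix d assume "d \<in> \<kappa> ` ?U"
    then obtain f where f: "f \<in> H" "h f f - inverse (\<pi> ^ r) \<in> \<O>" "d = \<kappa> f" by blast
    have "\<pi> ^ r * (h f f - inverse (\<pi> ^ r)) \<in> \<P> 1"
      using P_mono[OF pi_P r] f(2) by (intro P_mult_O)
    then have "nrm r f - 1 \<in> \<P> 1" by (simp add: nrm_def right_diff_distrib)
    then have "nrm r f \<in> units" by (rule units_cong[OF one_units])
    then have sp: "splits H r f" using H kH r f by (simp add: splits_def)
    have "card (\<kappa> ` killed i (orth H f)) = q ^ (2 * (\<Sum>j\<leftarrow>rs. min i j))" for i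
    proof -
      have "q ^ (2 * min i r) * card (\<kappa> ` killed i (orth H f)) = q ^ (2 * min i r) * q ^ (2 * (\<Sum>j\<leftarrow>rs. min i j))"
        using card_killed_split[OF sp, of i] cards[of i] by (simp add: power_add distrib_left flip: power_add)
      then show ?thesis using q_gt_1 by simp
    qed
    then have IH: "real (card (map \<kappa> ` frame_set (orth H f) rs)) = frame_count rs"
      using Cons.prems by (intro Cons.IH herm_sub_orth[OF sp]) auto
    have "card (map \<kappa> ` frame_set (orth H f) rs) = card (map \<kappa> ` {fs \<in> frame_set H (r # rs). \<kappa> (hd fs) = d})"
    proof (rule card_image_transfer[where t = "\<lambda>fs. f # fs"])
      show "f # fs \<in> {fs \<in> frame_set H (r # rs). \<kappa> (hd fs) = d}" if "fs \<in> frame_set (orth H f) rs" for fs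
        using that frame_set_Cons[OF f(1) kH f(2)] f(3) by simp
      show "\<exists>fs\<in>frame_set (orth H f) rs. map \<kappa> (f # fs) = map \<kappa> gs"
        if gs: "gs \<in> {fs \<in> frame_set H (r # rs). \<kappa> (hd fs) = d}" for gs
      proof -
        obtain g gs' where g: "gs = g # gs'" using gs by (auto simp: frame_set_def list_all2_Cons1)
        have gH: "g \<in> H" "h g g - inverse (\<pi> ^ r) \<in> \<O>" "\<kappa> g = \<kappa> f"
          using gs by (auto simp: g frame_set_def f(3))
        then have "gs' \<in> frame_set (orth H g) rs" using gs frame_set_Cons[OF gH(1) kH gH(2)] by (simp add: g)
        \<comment> \<open>The complement depends only on the class of f, so a frame beginning with
          another representative g can be made to begin with f.\<close>
        moreover have "orth H g = orth H f"
        proof -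
          have d: "g - f \<in> D" "f - g \<in> D" using gH(1,3) f(1) Hs(2) kappa[of g f] kappa[of f g] by auto
          have "h (g - f) w \<in> \<O>" "h (f - g) w \<in> \<O>" if "w \<in> H" for w
            using h_D[OF Hs(2)[OF that]] d h_O_commute by blast+
          then have "h g w \<in> \<O> \<longleftrightarrow> h f w \<in> \<O>" if "w \<in> H" for w
            using that O_add[of "h (g - f) w" "h f w"] O_add[of "h (f - g) w" "h g w"]
            by (auto simp: h_diff_left)
          then show ?thesis by (auto simp: orth_def)
        qed
        ultimately show ?thesis using gH(3) by (intro bexI[of _ gs']) (auto simp: g)
      qed
    qed auto
    then show "real (card (map \<kappa> ` {fs \<in> frame_set H (r # rs). \<kappa> (hd fs) = d})) = frame_count rs"
      using IH by simp
  qed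
  also have "\<dots> = frame_count (r # rs)"
  proof -
    have "real (q ^ (2 * sum_list (r # rs))) / real q ^ r = real q ^ (r + 2 * sum_list rs)"
      using q_gt_1 by (simp add: power_add mult_2)
    then show ?thesis unfolding unit_card cH by simp
  qed
  finally show ?case .
qed

end

section \<open>Automorphisms and orthogonal frames\<close>

context hermitian_lattice
begin

definition comb :: "(nat \<Rightarrow> 'b) \<Rightarrow> nat \<Rightarrow> (nat \<Rightarrow> 'a) \<Rightarrow> 'b" where
  "comb f n x = (\<Sum>i<n. sc (x i) (f i))"

lemma comb_Suc: "comb f (Suc n) x = comb f n x + sc (x n) (f n)"
  by (simp add: comb_def)

lemma comb_L:
  assumes "herm_sub H" "\<And>i. i < n \<Longrightarrow> f i \<in> H" "\<And>i. i < n \<Longrightarrow> x i \<in> \<O>"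
  shows "comb f n x \<in> H"
  using assms(2,3)
proof (induction n)
  case 0
  then show ?case using herm_subD(1)[OF assms(1)] D_zero by (simp add: comb_def)
next
  case (Suc n)
  then show ?case unfolding comb_Suc using herm_subD(3,4)[OF assms(1)] by auto
qed

text \<open>The relations \<pi>^(k i) f i = 0 in the quotient make the map sending x to
  \<open>comb f n x\<close> well defined on classes.\<close>

lemma comb_D:
  assumes "\<And>i. i < n \<Longrightarrow> sc (\<pi> ^ k i) (f i) \<in> D" "\<And>i. i < n \<Longrightarrow> x i \<in> \<P> (k i)"
  shows "comb f n x \<in> D"
  using assms
proof (induction n)
  case 0
  then show ?case by (simp add: comb_def D_zero)
next
  case (Suc n)
  have "x n / \<pi> ^ k n \<in> \<O>" using Suc.prems(2)[of n] by (simp add: P_iff)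
  from D_scale[OF this Suc.prems(1)[of n]] have "sc (x n) (f n) \<in> D" by simp
  then show ?case unfolding comb_Suc using Suc by (intro D_add) auto
qed

lemma comb_add: "comb f n (x + y) = comb f n x + comb f n y"
  by (simp add: comb_def vec.scale_left_distrib sum.distrib)

lemma comb_diff: "comb f n (x - y) = comb f n x - comb f n y"
  by (simp add: comb_def vec.scale_left_diff_distrib sum_subtractf)

lemma comb_scale: "comb f n (\<lambda>i. a * x i) = sc a (comb f n x)"
  by (simp add: comb_def vec.scale_sum_right)

lemma h_comb: "h z (comb f n y) = (\<Sum>j<n. y j * h z (f j))"
proof (induction n)
  case 0
  have "h z 0 = 0" using h_scale[of z 0 0] by simp
  then show ?case by (simp add: comb_def)
next
  case (Suc n)
  then show ?case unfolding comb_Suc by (simp add: h_simps)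
qed

lemma h_comb_left: "h (comb f n x) z = (\<Sum>i<n. star (x i) * h (f i) z)"
proof -
  have "h (comb f n x) z = star (h z (comb f n x))" by (simp add: h_star)
  also have "\<dots> = (\<Sum>i<n. star (x i) * h (f i) z)"
    unfolding h_comb by (simp add: star_sum star_mult h_star)
  finally show ?thesis .
qed

end

lemma sum_fun_apply: "(\<Sum>i\<in>A. g i) x = (\<Sum>i\<in>A. (g i :: 'b \<Rightarrow> 'c::comm_monoid_add) x)"
  by (induction A rule: infinite_finite_induct) auto

section \<open>The standard lattice presenting the module\<close>

context unramified_hermitian_field
begin

definition vscale :: "'a \<Rightarrow> (nat \<Rightarrow> 'a) \<Rightarrow> nat \<Rightarrow> 'a" where
  "vscale a x = (\<lambda>i. a * x i)"

definition form :: "nat list \<Rightarrow> (nat \<Rightarrow> 'a) \<Rightarrow> (nat \<Rightarrow> 'a) \<Rightarrow> 'a" where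
  "form lam x y = (\<Sum>i<length lam. inverse (\<pi> ^ (lam ! i)) * star (x i) * y i)"

text \<open>Coordinates beyond the length of \<open>lam\<close> are arbitrary; they vanish in the quotient.\<close>

definition lat :: "nat list \<Rightarrow> (nat \<Rightarrow> 'a) set" where
  "lat lam = {x. \<forall>i<length lam. x i \<in> \<O>}"

definition sublat :: "nat list \<Rightarrow> (nat \<Rightarrow> 'a) set" where
  "sublat lam = {x. \<forall>i<length lam. x i \<in> \<P> (lam ! i)}"

definition proj :: "nat list \<Rightarrow> (nat \<Rightarrow> 'a) \<Rightarrow> nat \<Rightarrow> 'a set" where
  "proj lam x = (\<lambda>i\<in>{..<length lam}. cls (lam ! i) (x i))"

lemma proj_eq_iff: "proj lam x = proj lam y \<longleftrightarrow> x - y \<in> sublat lam"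
proof
  assume e: "proj lam x = proj lam y"
  have "cls (lam ! i) (x i) = cls (lam ! i) (y i)" if "i < length lam" for i
    using fun_cong[OF e, of i] that by (simp add: proj_def)
  then show "x - y \<in> sublat lam" by (simp add: sublat_def cls_eq_iff)
next
  assume "x - y \<in> sublat lam"
  then show "proj lam x = proj lam y"
    unfolding proj_def by (intro restrict_ext) (simp add: sublat_def cls_eq_iff)
qed

lemma proj_image:
  "proj lam ` {x. \<forall>i<length lam. x i \<in> S i} = (\<Pi>\<^sub>E i\<in>{..<length lam}. cls (lam ! i) ` S i)"
proof
  show "proj lam ` {x. \<forall>i<length lam. x i \<in> S i} \<subseteq> (\<Pi>\<^sub>E i\<in>{..<length lam}. cls (lam ! i) ` S i)"
    by (auto simp: proj_def)
  show "(\<Pi>\<^sub>E i\<in>{..<length lam}. cls (lam ! i) ` S i) \<subseteq> proj lam ` {x. \<forall>i<length lam. x i \<in> S i}"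
  proof
    fix X assume X: "X \<in> (\<Pi>\<^sub>E i\<in>{..<length lam}. cls (lam ! i) ` S i)"
    then have "\<forall>i\<in>{..<length lam}. \<exists>x. x \<in> S i \<and> X i = cls (lam ! i) x" by (auto simp: PiE_iff)
    then obtain x where x: "\<forall>i\<in>{..<length lam}. x i \<in> S i \<and> X i = cls (lam ! i) (x i)" by (rule bchoice[THEN exE])
    have "X = proj lam x"
    proof
      fix i show "X i = proj lam x i"
        using x X by (cases "i < length lam") (auto simp: proj_def PiE_iff extensional_def)
    qed
    then show "X \<in> proj lam ` {x. \<forall>i<length lam. x i \<in> S i}" using x by auto
  qed
qed

lemma herm_carrier_eq: "herm_carrier v lam = proj lam ` lat lam"
  unfolding lat_def proj_image herm_carrier_def quot_conv ..

lemma form_sublat: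
  assumes "x \<in> lat lam" "y \<in> sublat lam" shows "form lam x y \<in> \<O>"
proof -
  have "inverse (\<pi> ^ (lam ! i)) * star (x i) * y i \<in> \<P> 0" if "i < length lam" for i
  proof -
    have "star (x i) * (y i / \<pi> ^ (lam ! i)) \<in> \<O>"
      using assms that by (intro O_mult) (auto simp: lat_def sublat_def P_iff)
    then show ?thesis by (simp add: P_0 divide_inverse mult_ac)
  qed
  then show ?thesis unfolding form_def P_0[symmetric] by (intro P_sum) auto
qed

lemma hermitian_lattice_lat:
  "hermitian_lattice v star \<pi> q vscale (form lam) (lat lam) (sublat lam) (proj lam)"
proof
  show "vscale a (x + y) = vscale a x + vscale a y" "vscale (a + b) x = vscale a x + vscale b x"
    "vscale a (vscale b x) = vscale (a * b) x" "vscale 1 x = x" for a b x y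
    by (auto simp: vscale_def algebra_simps)
  show "form lam x (y + z) = form lam x y + form lam x z" for x y z
    by (simp add: form_def sum.distrib algebra_simps)
  show "form lam x (vscale a y) = a * form lam x y" for x y a
    by (simp add: form_def vscale_def sum_distrib_left mult_ac)
  show "star (form lam x y) = form lam y x" for x y
    by (simp add: form_def star_sum star_mult star_inverse star_power star_star mult_ac)
  show "sublat lam \<subseteq> lat lam" by (auto simp: lat_def sublat_def intro: P_imp_O)
  show "0 \<in> sublat lam" by (simp add: sublat_def)
  show "x + y \<in> sublat lam" if "x \<in> sublat lam" "y \<in> sublat lam" for x y
    using that by (auto simp: sublat_def intro: P_add)
  show "vscale a x \<in> sublat lam" if "a \<in> \<O>" "x \<in> sublat lam" for a x
    using that by (auto simp: sublat_def vscale_def intro: P_mult_O)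
  show "form lam x d \<in> \<O>" if "x \<in> lat lam" "d \<in> sublat lam" for x d
    using that by (rule form_sublat)
  show "proj lam x = proj lam y \<longleftrightarrow> x - y \<in> sublat lam" for x y by (rule proj_eq_iff)
  show "finite (proj lam ` lat lam)"
    unfolding lat_def proj_image by (intro finite_PiE) (auto simp: finite_cls)
  show "\<exists>k. vscale (\<pi> ^ k) x \<in> sublat lam" if x: "x \<in> lat lam" for x
  proof -
    \<comment> \<open>The sum of the parts serves as a common upper bound for all of them.\<close>
    have "\<pi> ^ sum_list lam * x i \<in> \<P> (lam ! i)" if "i < length lam" for i
      using x that elem_le_sum_list[OF that] P_mono[OF pi_P] by (intro P_mult_O) (auto simp: lat_def)
    then show ?thesis by (intro exI[of _ "sum_list lam"]) (simp add: vscale_def sublat_def)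
  qed
qed

definition unit_vec :: "nat \<Rightarrow> nat \<Rightarrow> 'a" where
  "unit_vec i = (\<lambda>j. if j = i then 1 else 0)"

lemma unit_vec_lat: "unit_vec i \<in> lat lam"
  by (simp add: lat_def unit_vec_def)

lemma form_unit_vec:
  assumes i: "i < length lam"
  shows "form lam (unit_vec i) y = inverse (\<pi> ^ (lam ! i)) * y i"
proof -
  have "form lam (unit_vec i) y = (\<Sum>j<length lam. if j = i then inverse (\<pi> ^ (lam ! i)) * y i else 0)"
    unfolding form_def by (intro sum.cong) (auto simp: unit_vec_def)
  with i show ?thesis by simp
qed

lemma cls_self: "x \<in> cls k x"
  by (simp add: cls_def)

lemma cls_memD: "y \<in> cls k x \<Longrightarrow> x \<in> \<O> \<Longrightarrow> y \<in> \<O>" "y \<in> cls k x \<Longrightarrow> y - x \<in> \<P> k"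
  using O_add[of "y - x" x] P_imp_O by (auto simp: cls_def)

lemma herm_add_proj:
  assumes "x \<in> lat lam" "y \<in> lat lam"
  shows "herm_add v lam (proj lam x) (proj lam y) = proj lam (x + y)"
proof -
  have "(\<Union>a\<in>cls k b. \<Union>c\<in>cls k d. cong_rel v k `` {a + c}) = cls k (b + d)"
    if bd: "b \<in> \<O>" "d \<in> \<O>" for k b d
  proof -
    have "cong_rel v k `` {a + c} = cls k (b + d)" if "a \<in> cls k b" "c \<in> cls k d" for a c
    proof -
      have "a + c \<in> \<O>" using that bd cls_memD(1) by (intro O_add) blast+
      moreover have "(a - b) + (c - d) \<in> \<P> k" using that cls_memD(2) by (intro P_add)
      then have "cls k (a + c) = cls k (b + d)" unfolding cls_eq_iff by (simp add: algebra_simps)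
      ultimately show ?thesis by (simp only: cong_rel_cls)
    qed
    moreover have "b \<in> cls k b" "d \<in> cls k d" by (rule cls_self)+
    ultimately show ?thesis by blast
  qed
  then show ?thesis using assms unfolding herm_add_def proj_def
    by (intro restrict_ext) (simp add: lat_def)
qed

lemma herm_smult_proj:
  assumes "x \<in> lat lam" "a \<in> \<O>"
  shows "herm_smult v lam a (proj lam x) = proj lam (vscale a x)"
proof -
  have "(\<Union>c\<in>cls k b. cong_rel v k `` {a * c}) = cls k (a * b)" if b: "b \<in> \<O>" for k b
  proof -
    have "cong_rel v k `` {a * c} = cls k (a * b)" if "c \<in> cls k b" for c
    proof -
      have "a * c \<in> \<O>" using that b assms(2) cls_memD(1) by (intro O_mult) blast+
      moreover have "a * (c - b) \<in> \<P> k" using that cls_memD(2) assms(2) by (intro P_mult_O)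
      then have "cls k (a * c) = cls k (a * b)" unfolding cls_eq_iff by (simp add: algebra_simps)
      ultimately show ?thesis by (simp only: cong_rel_cls)
    qed
    moreover have "b \<in> cls k b" by (rule cls_self)
    ultimately show ?thesis by blast
  qed
  then show ?thesis using assms unfolding herm_smult_def proj_def
    by (intro restrict_ext) (simp add: lat_def vscale_def)
qed

lemma cong_integers_eq_iff: "cong_integers v `` {a} = cong_integers v `` {b} \<longleftrightarrow> a - b \<in> \<O>"
proof
  assume e: "cong_integers v `` {a} = cong_integers v `` {b}"
  have "a \<in> cong_integers v `` {a}" by (simp add: cong_integers_def)
  then have "b - a \<in> \<O>" unfolding e by (simp add: cong_integers_def)
  then show "a - b \<in> \<O>" using O_minus[of "b - a"] by simp
next
  assume ab: "a - b \<in> \<O>"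
  have "a - z \<in> \<O> \<longleftrightarrow> b - z \<in> \<O>" for z
    using O_diff[OF _ ab, of "a - z"] O_add[OF _ ab, of "b - z"] by auto
  then show "cong_integers v `` {a} = cong_integers v `` {b}" by (auto simp: cong_integers_def)
qed

lemma herm_pairing_proj:
  assumes x: "x \<in> lat lam" and y: "y \<in> lat lam"
  shows "herm_pairing v star \<pi> lam (proj lam x) (proj lam y) = cong_integers v `` {form lam x y}"
proof -
  interpret hl: hermitian_lattice v star \<pi> q vscale "form lam" "lat lam" "sublat lam" "proj lam"
    by (rule hermitian_lattice_lat)
  have Pi: "z' - z \<in> sublat lam \<and> z' \<in> lat lam" if "z' \<in> Pi {..<length lam} (proj lam z)" "z \<in> lat lam" for z z'
  proof -
    have "z' i \<in> cls (lam ! i) (z i)" "z i \<in> \<O>" if i: "i < length lam" for i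
      using \<open>z' \<in> _\<close> \<open>z \<in> _\<close> i by (auto simp: proj_def lat_def Pi_iff)
    then have "z' i \<in> \<O> \<and> z' i - z i \<in> \<P> (lam ! i)" if "i < length lam" for i
      using that cls_memD by blast
    then show ?thesis by (simp add: lat_def sublat_def)
  qed
  have "cong_integers v `` {form lam x' y'} = cong_integers v `` {form lam x y}"
    if "x' \<in> Pi {..<length lam} (proj lam x)" "y' \<in> Pi {..<length lam} (proj lam y)" for x' y'
  proof -
    have "form lam x' (y' - y) + form lam (x' - x) y \<in> \<O>"
      using Pi[OF that(1) x] Pi[OF that(2) y] y hl.h_D hl.h_O_commute by (intro O_add) blast+
    then show ?thesis unfolding cong_integers_eq_iff by (simp add: hl.h_simps)
  qed
  moreover have "z \<in> Pi {..<length lam} (proj lam z)" for z by (simp add: proj_def cls_self)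
  ultimately show ?thesis unfolding herm_pairing_def form_def[symmetric] by blast
qed

text \<open>In a coordinate with part l, an integer is killed by \<pi>^i exactly when it lies in
  p^(l-i), with truncated subtraction; this leaves q^(2 min(i, l)) classes.\<close>

lemma card_killed_lat:
  assumes "hermitian_lattice v star \<pi> q vscale (form lam) (lat lam) (sublat lam) (proj lam)"
  shows "card (proj lam ` hermitian_lattice.killed \<pi> vscale (sublat lam) i (lat lam)) = q ^ (2 * (\<Sum>j\<leftarrow>lam. min i j))"
proof -
  have "x \<in> \<O> \<and> \<pi> ^ i * x \<in> \<P> l \<longleftrightarrow> x \<in> \<P> (l - i)" for x l
  proof (cases "i \<le> l")
    case True
    then show ?thesis using P_pi_cancel[of i x "l - i"] P_imp_O by auto
  next
    case False
    then show ?thesis using P_mult_O(1)[OF P_mono[OF pi_P, of l i], of x] by (auto simp: P_0)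
  qed
  then have "hermitian_lattice.killed \<pi> vscale (sublat lam) i (lat lam) = {x. \<forall>j<length lam. x j \<in> \<P> (lam ! j - i)}"
    unfolding hermitian_lattice.killed_def[OF assms] by (auto simp: lat_def sublat_def vscale_def)
  then have "card (proj lam ` hermitian_lattice.killed \<pi> vscale (sublat lam) i (lat lam))
      = (\<Prod>j<length lam. q ^ (2 * (lam ! j - (lam ! j - i))))"
    by (simp add: proj_image card_PiE card_cls_P)
  also have "\<dots> = q ^ (2 * (\<Sum>j<length lam. min (lam ! j) i))"
  proof -
    have "lam ! j - (lam ! j - i) = min (lam ! j) i" for j by simp
    then show ?thesis by (simp only: power_sum[symmetric] sum_distrib_left)
  qed
  also have "(\<Sum>j<length lam. min (lam ! j) i) = (\<Sum>j\<leftarrow>lam. min i j)"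
    by (simp add: sum_list_sum_nth atLeast0LessThan min.commute)
  finally show ?thesis .
qed

end

lemma n_stat_Cons: "n_stat (r # rs) = sum_list rs + n_stat rs"
  by (simp add: n_stat_def sum.lessThan_Suc_shift sum_list_sum_nth atLeast0LessThan sum.distrib del: sum.lessThan_Suc)

section \<open>Closed form of the frame count\<close>

context hermitian_lattice
begin

text \<open>Prepending r raises \<open>n_stat\<close> by the sum of the remaining parts and
  multiplies the symbol at r by 1 - (-1/q)^m, with m the new multiplicity. Elements of A that are
  not parts contribute empty products.\<close>

lemma frame_count_eq:
  assumes "finite A" "set rs \<subseteq> A"
  shows "frame_count rs = real q ^ (sum_list rs + 2 * n_stat rs) *
    (\<Prod>i\<in>A. q_poch (- (1 / real q)) (- (1 / real q)) (count_list rs i))"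
  using assms(2)
proof (induction rs)
  case Nil
  then show ?case by (simp add: n_stat_def q_poch_def)
next
  case (Cons r rs)
  let ?x = "- (1 / real q)"
  have r: "r \<in> A" using Cons.prems by simp
  have "(\<Prod>i\<in>A. q_poch ?x ?x (count_list (r # rs) i))
      = q_poch ?x ?x (Suc (count_list rs r)) * (\<Prod>i\<in>A - {r}. q_poch ?x ?x (count_list rs i))"
    unfolding prod.remove[OF assms(1) r] by (intro arg_cong2[of _ _ _ _ "(*)"] prod.cong) auto
  also have "q_poch ?x ?x (Suc (count_list rs r))
      = (1 - ?x ^ count_list (r # rs) r) * q_poch ?x ?x (count_list rs r)"
    by (simp add: q_poch_def)
  finally have "(\<Prod>i\<in>A. q_poch ?x ?x (count_list (r # rs) i))
      = (1 - ?x ^ count_list (r # rs) r) * (\<Prod>i\<in>A. q_poch ?x ?x (count_list rs i))"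
    unfolding prod.remove[OF assms(1) r, of "\<lambda>i. q_poch ?x ?x (count_list rs i)"] by (simp only: mult.assoc)
  moreover have "sum_list (r # rs) + 2 * n_stat (r # rs) = (r + 2 * sum_list rs) + (sum_list rs + 2 * n_stat rs)"
    by (simp add: n_stat_Cons)
  moreover have "frame_count rs = real q ^ (sum_list rs + 2 * n_stat rs) * (\<Prod>i\<in>A. q_poch ?x ?x (count_list rs i))"
    using Cons by simp
  ultimately show ?case unfolding frame_count.simps(2) by (simp only: power_add mult_ac)
qed

end

section \<open>Automorphisms as frames\<close>

context unramified_hermitian_field
begin

text \<open>An automorphism is encoded by the classes of its values on the unit vectors. The bound
  \<open>Max\<close> makes the product over all i >= 1 finite, and inserting 0 covers the empty
  type.\<close>

lemma card_herm_aut: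
  assumes lam: "is_type lam"
  shows "real (card (herm_aut v star \<pi> lam)) = real q ^ (sum_list lam + 2 * n_stat lam) *
    (\<Prod>i\<in>{1..Max (insert 0 (set lam))}. q_poch (- (1 / real q)) (- (1 / real q)) (count_list lam i))"
proof -
  define n where "n = length lam"
  define K where "K = proj lam"
  interpret hl: hermitian_lattice v star \<pi> q vscale "form lam" "lat lam" "sublat lam" K
    unfolding K_def by (rule hermitian_lattice_lat)
  let ?L = "lat lam" and ?D = "sublat lam" and ?F = "hl.frame_set (lat lam) lam" and ?h = "form lam"
  let ?A = "herm_aut v star \<pi> lam"
  \<comment> \<open>Only the classes agree: the combination loses the coordinates beyond n.\<close>
  have vec_comb: "K x = K (hl.comb unit_vec n x)" for x
  proof -
    have "hl.comb unit_vec n x j = x j" if "j < n" for j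
    proof -
      have "hl.comb unit_vec n x j = (\<Sum>i<n. if i = j then x j else 0)"
        unfolding hl.comb_def sum_fun_apply by (intro sum.cong) (auto simp: vscale_def unit_vec_def)
      with that show ?thesis by simp
    qed
    then show ?thesis by (simp add: K_def proj_eq_iff sublat_def n_def)
  qed
  have comb_unit: "hl.comb f n (unit_vec i) = f i" if "i < n" for f i
  proof -
    have "hl.comb f n (unit_vec i) = (\<Sum>j<n. if j = i then f i else 0)"
      unfolding hl.comb_def by (intro sum.cong) (auto simp: vscale_def unit_vec_def)
    with that show ?thesis by simp
  qed
  \<comment> \<open>A Gram matrix correct modulo o suffices, because the coordinates of x and y are
    integral.\<close>
  have h_comb: "?h (hl.comb f n x) (hl.comb f n y) - ?h x y \<in> \<O>"
    if x: "x \<in> ?L" and y: "y \<in> ?L"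
      and f: "\<And>i j. i < n \<Longrightarrow> j < n \<Longrightarrow> ?h (f i) (f j) - (if i = j then inverse (\<pi> ^ (lam ! i)) else 0) \<in> \<O>"
    for f x y
  proof -
    have "?h x y = (\<Sum>i<n. star (x i) * (\<Sum>j<n. y j * (if i = j then inverse (\<pi> ^ (lam ! i)) else 0)))"
      unfolding form_def n_def by (intro sum.cong) (auto simp: if_distrib cong: if_cong)
    then have "?h (hl.comb f n x) (hl.comb f n y) - ?h x y =
        (\<Sum>i<n. star (x i) * (\<Sum>j<n. y j * (?h (f i) (f j) - (if i = j then inverse (\<pi> ^ (lam ! i)) else 0))))"
      by (subst hl.h_comb_left) (simp only: hl.h_comb right_diff_distrib sum_subtractf)
    also have "\<dots> \<in> \<P> 0"
      using x y f by (intro P_sum P_mult_O) (auto simp: lat_def n_def P_0)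
    finally show ?thesis by (simp only: P_0)
  qed
  have L: "hl.herm_sub ?L"
  proof -
    have "x \<in> ?D" if "x \<in> ?L" "\<forall>y\<in>?L. ?h x y \<in> \<O>" for x
    proof -
      have "inverse (\<pi> ^ (lam ! i)) * x i \<in> \<O>" if i: "i < length lam" for i
      proof -
        have "?h x (unit_vec i) \<in> \<O>" using \<open>\<forall>y\<in>?L. ?h x y \<in> \<O>\<close> unit_vec_lat by blast
        then have "?h (unit_vec i) x \<in> \<O>" by (simp only: hl.h_O_commute[of _ x])
        then show ?thesis by (simp only: form_unit_vec[OF i])
      qed
      then show ?thesis by (simp add: sublat_def P_iff divide_inverse mult.commute)
    qed
    then show ?thesis unfolding hl.herm_sub_def
      using hl.D_sub_L by (auto simp: lat_def vscale_def intro: O_add O_mult)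
  qed
  note Ls = hl.herm_subD[OF L]
  have carrier: "herm_carrier v lam = K ` ?L" by (simp add: herm_carrier_eq K_def)
  have aut: "\<phi> \<in> ?A \<longleftrightarrow> \<phi> \<in> extensional (K ` ?L) \<and> bij_betw \<phi> (K ` ?L) (K ` ?L) \<and>
      (\<forall>x\<in>?L. \<forall>y\<in>?L. \<phi> (K (x + y)) = herm_add v lam (\<phi> (K x)) (\<phi> (K y))) \<and>
      (\<forall>a\<in>\<O>. \<forall>x\<in>?L. \<phi> (K (vscale a x)) = herm_smult v lam a (\<phi> (K x))) \<and>
      (\<forall>x\<in>?L. \<forall>y\<in>?L. herm_pairing v star \<pi> lam (\<phi> (K x)) (\<phi> (K y)) = cong_integers v `` {?h x y})" for \<phi>
    unfolding herm_aut_def carrier mem_Collect_eq ball_simps K_def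
    by (simp add: herm_add_proj herm_smult_proj herm_pairing_proj cong: ball_cong)
  have autD: "\<phi> \<in> extensional (K ` ?L)" "\<And>x. x \<in> ?L \<Longrightarrow> \<phi> (K x) \<in> K ` ?L"
    "\<And>x y. x \<in> ?L \<Longrightarrow> y \<in> ?L \<Longrightarrow> \<phi> (K (x + y)) = herm_add v lam (\<phi> (K x)) (\<phi> (K y))"
    "\<And>a x. a \<in> \<O> \<Longrightarrow> x \<in> ?L \<Longrightarrow> \<phi> (K (vscale a x)) = herm_smult v lam a (\<phi> (K x))"
    "\<And>x y. x \<in> ?L \<Longrightarrow> y \<in> ?L \<Longrightarrow> herm_pairing v star \<pi> lam (\<phi> (K x)) (\<phi> (K y)) = cong_integers v `` {?h x y}"
    if "\<phi> \<in> ?A" for \<phi>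
    using that[unfolded aut] bij_betwE by blast+
  have reps: "\<exists>f. \<forall>i. f i \<in> ?L \<and> \<phi> (K (unit_vec i)) = K (f i)" if "\<phi> \<in> ?A" for \<phi>
  proof (rule choice, rule allI)
    fix i
    have "\<phi> (K (unit_vec i)) \<in> K ` ?L"
      by (rule autD(2)[OF that unit_vec_lat])
    then show "\<exists>y. y \<in> ?L \<and> \<phi> (K (unit_vec i)) = K y" by auto
  qed
  have zero: "\<phi> (K 0) = K 0" if "\<phi> \<in> ?A" for \<phi>
  proof -
    have 0: "0 \<in> ?L" using hl.D_zero Ls(1) by blast
    have "\<phi> (K 0) \<in> K ` ?L" by (rule autD(2)[OF that 0])
    then obtain y where y: "y \<in> ?L" "\<phi> (K 0) = K y" by auto
    have "\<phi> (K (vscale 0 0)) = herm_smult v lam 0 (K y)"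
      unfolding y(2)[symmetric] by (rule autD(4)[OF that O_zero 0])
    also have "\<dots> = K (vscale 0 y)" unfolding K_def by (rule herm_smult_proj) (simp_all add: y)
    finally show ?thesis by (simp add: vscale_def zero_fun_def)
  qed
  have aut_comb: "\<phi> (K x) = K (hl.comb f n x)"
    if \<phi>: "\<phi> \<in> ?A" and f: "\<And>i. i < n \<Longrightarrow> f i \<in> ?L \<and> \<phi> (K (unit_vec i)) = K (f i)" and x: "x \<in> ?L" for \<phi> f x
  proof -
    have "m \<le> n \<Longrightarrow> \<phi> (K (hl.comb unit_vec m x)) = K (hl.comb f m x)" for m
    proof (induction m)
      case 0
      then show ?case by (simp only: hl.comb_def lessThan_0 sum.empty zero[OF \<phi>])
    next
      case (Suc m)
      have xi: "x i \<in> \<O>" if "i < n" for i using x that by (simp add: lat_def n_def)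
      have fL: "f i \<in> ?L" if "i < n" for i using f that by blast
      have c: "hl.comb g m x \<in> ?L" if "\<And>i. i < m \<Longrightarrow> g i \<in> ?L" for g
        using hl.comb_L[OF L that] xi Suc.prems by simp
      have c: "hl.comb unit_vec m x \<in> ?L" "hl.comb f m x \<in> ?L"
        using c[OF unit_vec_lat] c[of f] fL Suc.prems by auto
      have s: "vscale (x m) (unit_vec m) \<in> ?L" "vscale (x m) (f m) \<in> ?L"
        using Suc.prems Ls(4)[OF xi unit_vec_lat] Ls(4)[OF xi fL] by auto
      have "\<phi> (K (hl.comb unit_vec (Suc m) x))
          = herm_add v lam (\<phi> (K (hl.comb unit_vec m x))) (\<phi> (K (vscale (x m) (unit_vec m))))"
        unfolding hl.comb_Suc by (rule autD(3)[OF \<phi> c(1) s(1)])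
      also have "\<phi> (K (vscale (x m) (unit_vec m))) = herm_smult v lam (x m) (\<phi> (K (unit_vec m)))"
        using xi[of m] Suc.prems by (intro autD(4)[OF \<phi> _ unit_vec_lat]) auto
      also have "\<phi> (K (unit_vec m)) = K (f m)" using f Suc.prems by simp
      also have "herm_smult v lam (x m) (K (f m)) = K (vscale (x m) (f m))"
        unfolding K_def using fL[of m] xi[of m] Suc.prems by (intro herm_smult_proj) auto
      also have "\<phi> (K (hl.comb unit_vec m x)) = K (hl.comb f m x)" using Suc by simp
      also have "herm_add v lam (K (hl.comb f m x)) (K (vscale (x m) (f m))) = K (hl.comb f (Suc m) x)"
        unfolding hl.comb_Suc K_def using c(2) s(2) by (rule herm_add_proj)
      finally show ?case .
    qed
    from this[OF order_refl] show ?thesis using vec_comb[of x] by simp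
  qed
  \<comment> \<open>The list condition becomes one on the full Gram matrix; entries below the
    diagonal follow by conjugation.\<close>
  have frameD: "f ` {..<n} \<subseteq> ?L \<Longrightarrow> map f [0..<n] \<in> ?F \<longleftrightarrow>
      (\<forall>i<n. vscale (\<pi> ^ (lam ! i)) (f i) \<in> ?D) \<and>
      (\<forall>i<n. \<forall>j<n. ?h (f i) (f j) - (if i = j then inverse (\<pi> ^ (lam ! i)) else 0) \<in> \<O>)" for f
  proof -
    assume sub: "f ` {..<n} \<subseteq> ?L"
    have "map f [0..<n] \<in> ?F \<longleftrightarrow> (\<forall>i<n. vscale (\<pi> ^ (lam ! i)) (f i) \<in> ?D) \<and>
       (\<forall>i<n. ?h (f i) (f i) - inverse (\<pi> ^ (lam ! i)) \<in> \<O>) \<and> (\<forall>i j. i < j \<longrightarrow> j < n \<longrightarrow> ?h (f i) (f j) \<in> \<O>)"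
      using sub by (auto simp: hl.frame_set_def list_all2_conv_all_nth sorted_wrt_iff_nth_less n_def)
    also have "\<dots> \<longleftrightarrow> (\<forall>i<n. vscale (\<pi> ^ (lam ! i)) (f i) \<in> ?D) \<and>
      (\<forall>i<n. \<forall>j<n. ?h (f i) (f j) - (if i = j then inverse (\<pi> ^ (lam ! i)) else 0) \<in> \<O>)"
      (is "?P \<and> ?Q \<and> ?R \<longleftrightarrow> ?P \<and> ?S")
    proof -
      have "?S" if "?Q" "?R"
      proof (intro allI impI)
        fix i j assume ij: "i < n" "j < n"
        consider "i = j" | "i < j" | "j < i" by linarith
        then show "?h (f i) (f j) - (if i = j then inverse (\<pi> ^ (lam ! i)) else 0) \<in> \<O>"
          using that ij hl.h_O_commute[of "f i" "f j"] by cases auto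
      qed
      moreover have "?Q" if "?S" using that by fastforce
      moreover have "?R" if S: "?S"
      proof (intro allI impI)
        fix i j assume "i < j" "j < n"
        then show "?h (f i) (f j) \<in> \<O>" using S[rule_format, of i j] by simp
      qed
      ultimately show ?thesis by blast
    qed
    finally show ?thesis .
  qed
  have "bij_betw (\<lambda>\<phi>. map (\<lambda>i. \<phi> (K (unit_vec i))) [0..<n]) ?A (map K ` ?F)"
  proof (rule bij_betwI')
    fix \<phi> \<psi> assume A: "\<phi> \<in> ?A" "\<psi> \<in> ?A"
    show "(map (\<lambda>i. \<phi> (K (unit_vec i))) [0..<n] = map (\<lambda>i. \<psi> (K (unit_vec i))) [0..<n]) \<longleftrightarrow> \<phi> = \<psi>"
    proof
      assume e: "map (\<lambda>i. \<phi> (K (unit_vec i))) [0..<n] = map (\<lambda>i. \<psi> (K (unit_vec i))) [0..<n]"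
      obtain f where f: "\<forall>i. f i \<in> ?L \<and> \<phi> (K (unit_vec i)) = K (f i)" using reps[OF A(1)] by blast
      with e have f': "\<psi> (K (unit_vec i)) = K (f i)" if "i < n" for i using that by simp
      have "\<phi> (K x) = \<psi> (K x)" if "x \<in> ?L" for x
        using aut_comb[OF A(1) _ that, of f] aut_comb[OF A(2) _ that, of f] f f' by simp
      moreover have "\<phi> \<in> extensional (K ` ?L)" "\<psi> \<in> extensional (K ` ?L)" using A by (auto intro: autD(1))
      ultimately show "\<phi> = \<psi>" by (intro extensionalityI[of _ "K ` ?L"]) auto
    qed simp
  next
    fix \<phi> assume A: "\<phi> \<in> ?A"
    obtain f where f: "\<forall>i. f i \<in> ?L \<and> \<phi> (K (unit_vec i)) = K (f i)" using reps[OF A] by blast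
    have "vscale (\<pi> ^ (lam ! i)) (f i) \<in> ?D" if i: "i < n" for i
    proof -
      have "vscale (\<pi> ^ (lam ! i)) (unit_vec i) \<in> ?D"
        by (auto simp: sublat_def vscale_def unit_vec_def pi_P)
      then have "K (vscale (\<pi> ^ (lam ! i)) (unit_vec i)) = K 0" by (simp add: K_def proj_eq_iff)
      moreover have "\<phi> (K (vscale (\<pi> ^ (lam ! i)) (unit_vec i))) = herm_smult v lam (\<pi> ^ (lam ! i)) (K (f i))"
        unfolding f[rule_format, THEN conjunct2, symmetric] by (rule autD(4)[OF A pi_O unit_vec_lat])
      moreover have "herm_smult v lam (\<pi> ^ (lam ! i)) (K (f i)) = K (vscale (\<pi> ^ (lam ! i)) (f i))"
        unfolding K_def using f pi_O by (intro herm_smult_proj) auto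
      ultimately have "K (vscale (\<pi> ^ (lam ! i)) (f i)) = K 0" using zero[OF A] by simp
      then show ?thesis by (simp add: K_def proj_eq_iff)
    qed
    moreover have "?h (f i) (f j) - (if i = j then inverse (\<pi> ^ (lam ! i)) else 0) \<in> \<O>" if ij: "i < n" "j < n" for i j
    proof -
      have "cong_integers v `` {?h (f i) (f j)} = herm_pairing v star \<pi> lam (K (f i)) (K (f j))"
        unfolding K_def using f by (intro herm_pairing_proj[symmetric]) auto
      also have "\<dots> = cong_integers v `` {?h (unit_vec i) (unit_vec j)}"
        unfolding f[rule_format, THEN conjunct2, symmetric] by (rule autD(5)[OF A unit_vec_lat unit_vec_lat])
      also have "?h (unit_vec i) (unit_vec j) = (if i = j then inverse (\<pi> ^ (lam ! i)) else 0)"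
        using ij form_unit_vec[of i lam "unit_vec j"] by (simp add: n_def unit_vec_def)
      finally show ?thesis unfolding cong_integers_eq_iff .
    qed
    ultimately have "map f [0..<n] \<in> ?F" using frameD[of f] f by auto
    moreover have "map (\<lambda>i. \<phi> (K (unit_vec i))) [0..<n] = map K (map f [0..<n])" using f by simp
    ultimately show "map (\<lambda>i. \<phi> (K (unit_vec i))) [0..<n] \<in> map K ` ?F" by blast
  next
    fix Fs assume "Fs \<in> map K ` ?F"
    then obtain fs where fs: "fs \<in> ?F" "Fs = map K fs" by blast
    define f where "f i = fs ! i" for i
    have len: "length fs = n" using fs(1) by (auto simp: hl.frame_set_def n_def dest: list_all2_lengthD)
    then have fs_eq: "fs = map f [0..<n]" by (auto simp: f_def intro: nth_equalityI)
    have fL: "f i \<in> ?L" if "i < n" for i using fs(1) that len by (auto simp: hl.frame_set_def f_def)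
    have "f ` {..<n} \<subseteq> ?L" using fL by blast
    from iffD1[OF frameD[OF this] fs(1)[unfolded fs_eq]]
    have fr: "\<And>i. i < n \<Longrightarrow> vscale (\<pi> ^ (lam ! i)) (f i) \<in> ?D"
      "\<And>i j. i < n \<Longrightarrow> j < n \<Longrightarrow> ?h (f i) (f j) - (if i = j then inverse (\<pi> ^ (lam ! i)) else 0) \<in> \<O>"
      by blast+
    \<comment> \<open>\<open>inv_into\<close> picks some representative of X, and
      \<open>diff\<close> below shows that the choice does not matter.\<close>
    define \<phi> where "\<phi> = (\<lambda>X\<in>K ` ?L. K (hl.comb f n (inv_into ?L K X)))"
    have cL: "hl.comb f n x \<in> ?L" if "x \<in> ?L" for x
      by (rule hl.comb_L[OF L fL]) (use that in \<open>simp_all add: lat_def n_def\<close>)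
    have diff: "K (hl.comb f n x) = K (hl.comb f n y)" if "x \<in> ?L" "y \<in> ?L" "K x = K y" for x y
    proof -
      have "x - y \<in> ?D" using that hl.kappa by blast
      then have "hl.comb f n (x - y) \<in> ?D"
        by (intro hl.comb_D[where k = "\<lambda>i. lam ! i"] fr(1)) (simp_all add: sublat_def n_def)
      then show ?thesis using that cL by (simp add: hl.kappa hl.comb_diff)
    qed
    have \<phi>: "\<phi> (K x) = K (hl.comb f n x)" if x: "x \<in> ?L" for x
    proof -
      have "inv_into ?L K (K x) \<in> ?L" "K (inv_into ?L K (K x)) = K x"
        by (rule inv_into_into[OF imageI[OF x]], rule f_inv_into_f[OF imageI[OF x]])
      from diff[OF this(1) x this(2)] show ?thesis unfolding \<phi>_def restrict_apply'[OF imageI[OF x]] .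
    qed
    \<comment> \<open>If the image of x - y vanishes, preservation of the pairing makes x - y pair
      integrally with everything, so it lies in D by nondegeneracy. Surjectivity then follows from
      finiteness.\<close>
    have inj: "inj_on \<phi> (K ` ?L)"
    proof (rule inj_onI)
      fix X Y assume "X \<in> K ` ?L" "Y \<in> K ` ?L" and e: "\<phi> X = \<phi> Y"
      then obtain x y where xy: "x \<in> ?L" "y \<in> ?L" "X = K x" "Y = K y" by blast
      have xyL: "x - y \<in> ?L" using xy by (intro hl.herm_sub_diff[OF L])
      have "hl.comb f n (x - y) \<in> ?D" using e xy cL by (simp add: \<phi> hl.kappa hl.comb_diff)
      have "x - y \<in> ?D"
      proof (rule Ls(5)[OF xyL])
        fix z assume z: "z \<in> ?L"
        have "?h (hl.comb f n (x - y)) (hl.comb f n z) \<in> \<O>"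
          using hl.h_D[OF cL[OF z] \<open>hl.comb f n (x - y) \<in> ?D\<close>] hl.h_O_commute by blast
        from O_diff[OF this h_comb[OF xyL z fr(2)]] show "?h (x - y) z \<in> \<O>" by simp
      qed
      then show "X = Y" using xy by (simp add: hl.kappa)
    qed
    have "\<phi> ` K ` ?L \<subseteq> K ` ?L" using \<phi> cL by auto
    then have "\<phi> ` K ` ?L = K ` ?L" using inj by (rule endo_inj_surj[OF hl.finite_kappa])
    with inj have "bij_betw \<phi> (K ` ?L) (K ` ?L)" by (simp add: bij_betw_def)
    moreover have "\<phi> \<in> extensional (K ` ?L)" by (simp add: \<phi>_def)
    moreover have "\<phi> (K (x + y)) = herm_add v lam (\<phi> (K x)) (\<phi> (K y))" if "x \<in> ?L" "y \<in> ?L" for x y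
      using that cL Ls(3)[OF that] herm_add_proj[OF cL[OF that(1)] cL[OF that(2)]]
      by (simp add: \<phi> hl.comb_add K_def[symmetric])
    moreover have "\<phi> (K (vscale a x)) = herm_smult v lam a (\<phi> (K x))" if "a \<in> \<O>" "x \<in> ?L" for a x
      using that cL Ls(4)[OF that] herm_smult_proj[OF cL[OF that(2)] that(1)] hl.comb_scale[of f n a x, folded vscale_def]
      by (simp add: \<phi> K_def[symmetric])
    moreover have "herm_pairing v star \<pi> lam (\<phi> (K x)) (\<phi> (K y)) = cong_integers v `` {?h x y}"
      if "x \<in> ?L" "y \<in> ?L" for x y
      using herm_pairing_proj[OF cL[OF that(1)] cL[OF that(2)]] h_comb[OF that fr(2)] that
      by (simp add: \<phi> K_def[symmetric] cong_integers_eq_iff)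
    ultimately have "\<phi> \<in> ?A" unfolding aut by blast
    moreover have "Fs = map (\<lambda>i. \<phi> (K (unit_vec i))) [0..<n]"
      using comb_unit by (simp add: fs(2) fs_eq \<phi> unit_vec_lat)
    ultimately show "\<exists>\<phi>\<in>?A. Fs = map (\<lambda>i. \<phi> (K (unit_vec i))) [0..<n]" by blast
  qed
  then have "card ?A = card (map K ` ?F)" by (rule bij_betw_same_card)
  also have "real \<dots> = hl.frame_count lam"
  proof (rule hl.card_frames[OF L])
    show "sorted_wrt (\<ge>) lam" "\<forall>l\<in>set lam. 1 \<le> l" using lam by (auto simp: is_type_def)
    show "card (K ` hl.killed i ?L) = q ^ (2 * (\<Sum>j\<leftarrow>lam. min i j))" for i
      using card_killed_lat[OF hermitian_lattice_lat] by (simp add: K_def)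
  qed
  also have "\<dots> = real q ^ (sum_list lam + 2 * n_stat lam) *
    (\<Prod>i\<in>{1..Max (insert 0 (set lam))}. q_poch (- (1 / real q)) (- (1 / real q)) (count_list lam i))"
    using lam by (intro hl.frame_count_eq) (auto simp: is_type_def)
  finally show ?thesis .
qed

end

theorem theorem5p3:
  fixes v :: "'a::field \<Rightarrow> int"
    and star :: "'a \<Rightarrow> 'a"
    and \<pi> :: 'a
    and q :: nat
    and lam :: "nat list"
  assumes "nonarch_local_field v"
    and "field_involution star"
    and "unramified_over v (fixed_field star)"
    and "\<pi> \<in> fixed_field star \<inter> max_ideal v"
    and "max_ideal v = {\<pi> * a | a. a \<in> integers v}"
    and "q ^ 2 = card (quot v 1)"
    and "is_type lam"
  shows "real (card (herm_aut v star \<pi> lam)) =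
    real q ^ (sum_list lam + 2 * n_stat lam) *
    (\<Prod>i\<in>{1..Max (insert 0 (set lam))}.
       q_poch (- (1 / real q)) (- (1 / real q)) (count_list lam i))"
proof -
  interpret nonarch_local_field v by fact
  \<comment> \<open>An element of valuation 1 is an integral multiple of \<pi>, which forces \<pi>
    to have valuation 1 as well.\<close>
  obtain x where x: "x \<noteq> 0" "v x = 1" using val_normalised by blast
  then have "x \<in> max_ideal v" by (simp add: max_ideal_def pow_ideal_def)
  then obtain a where a: "x = \<pi> * a" "a \<in> integers v" using assms(5) by blast
  with x have nz: "\<pi> \<noteq> 0" "a \<noteq> 0" by auto
  have "v \<pi> \<ge> 1" using assms(4) nz by (simp add: max_ideal_def pow_ideal_def)
  moreover have "v \<pi> + v a = 1" using x(2) unfolding a(1) by (simp add: val_mult nz)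
  moreover have "v a \<ge> 0" using a(2) nz by (simp add: integers_def)
  ultimately have "v \<pi> = 1" by linarith
  then have "unramified_hermitian_field v star \<pi> q"
    using assms(1,2,4,6) nz by (simp add: unramified_hermitian_field_def unramified_hermitian_field_axioms_def fixed_field_def)
  then show ?thesis using assms(7) by (rule unramified_hermitian_field.card_herm_aut)
qed

end
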